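(* Let $(\Gamma_{i,j})_{i,j\ge 1}$ be real numbers satisfying $0\le \Gamma_{i,j}=\Gamma_{j,i}$ for all $i,j\ge 1$. Let $(\varphi_{i,j;k})$, $1\le i\le j-1$, $j\ge 2$, $k\ge 1$, be non-negative real numbers satisfying $$\sum_{i=1}^{j-1} i\,\varphi_{i,j;k} = j,\qquad j\ge 2,\ k\ge 1,$$ and suppose there are constants $\alpha_0,\alpha_1\ge 0$ such that $$\varphi_{i,j;k}\le \alpha_0+\alpha_1\varphi_{i,k;j}\qquad\text{for all } 1\le i\le j-1,\ k\ge j.$$ Let $\psi^{\mathrm{in}}=(\psi_i^{\mathrm{in}})_{i\ge 1}\in Y_{1,+}$ be such that $\sum_{i=1}^\infty G_0(i)\psi_i^{\mathrm{in}}<\infty$ for some $G_0\in\mathcal{G}_{1,\infty}$. Then there exists at least one global mild solution $\psi=(\psi_i)_{i\ge 1}$ to the nonlinear breakage system (with initial condition $\psi^{\mathrm{in}}$) which has both of the following properties: 1. (Mass conservation) $\|\psi(t)\|_1=\|\psi^{\mathrm{in}}\|_1$ for all $t\ge 0$. 2. (Tail estimate) For any non-negative sequence $(\Lambda_i)_{i\ge 1}$ such that $(\Lambda_i/i)_{i\ge 1}$ is non-decreasing and $\sum_{i=1}^\infty \Lambda_i\psi_i^{\mathrm{in}}<\infty$, one has $$\sum_{i=r}^\infty \Lambda_i\psi_i(t)\le \sum_{i=r}^\infty \Lambda_i\psi_i^{\mathrm{in}}\qquad\text{for all } t>0 \text{ and } r\ge 1.$$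
   Context: All indices are positive integers. Spaces: $Y_1$ is the Banach space of real sequences $\psi=(\psi_i)_{i\ge 1}$ with $\|\psi\|_1:=\sum_{i=1}^\infty i|\psi_i|<\infty$, and $Y_{1,+}:=\{\psi\in Y_1:\psi_i\ge 0 \text{ for each } i\ge 1\}$. The class $\mathcal{G}_{1,\infty}$: $\mathcal{G}_1$ is the set of non-negative convex functions $G\in C^2([0,\infty))$ such that $G(0)=G'(0)=0$ and $G'$ is concave; $\mathcal{G}_{1,\infty}:=\{G\in\mathcal{G}_1:\lim_{\zeta\to\infty}\frac{\zeta G'(\zeta)-G(\zeta)}{\zeta}=\infty\}$. Nonlinear breakage system: $$\frac{d\psi_i}{dt}=\sum_{j=i+1}^\infty\sum_{k=1}^\infty\varphi_{i,j;k}\Gamma_{j,k}\psi_j\psi_k-(1-\delta_{i,1})\sum_{j=1}^\infty\Gamma_{i,j}\psi_i\psi_j,\qquad \psi_i(0)=\psi_i^{\mathrm{in}},\qquad i\ge 1,$$ where $\delta_{1,1}=1$ and $\delta_{i,1}=0$ for $i\ge 2$. Global mild solution: a sequence $\psi=(\psi_i)_{i\ge 1}$ of non-negative functions, $\psi\in L^\infty((0,\infty),Y_{1,+})$, such that for each $i\ge 1$ and $t>0$: (i) $\psi_i\in C([0,\infty))$; (ii) $\sum_{j=i+1}^\infty\sum_{k=1}^\infty\varphi_{i,j;k}\Gamma_{j,k}\psi_j\psi_k\in L^1((0,t))$ and $\sum_{j=1}^\infty\Gamma_{i,j}\psi_i\psi_j\in L^1((0,t))$; (iii) $$\psi_i(t)=\psi_i^{\mathrm{in}}+\int_0^t\sum_{j=i+1}^\infty\sum_{k=1}^\infty\varphi_{i,j;k}\Gamma_{j,k}\psi_j(s)\psi_k(s)\,ds-(1-\delta_{i,1})\int_0^t\sum_{j=1}^\infty\Gamma_{i,j}\psi_i(s)\psi_j(s)\,ds.$$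 *)

theory Defs
  imports "HOL-Analysis.Analysis"
begin

text \<open>
  Sequences indexed by the positive integers are functions on \<^typ>\<open>nat\<close> whose value at \<open>0\<close> is
  irrelevant.  Likewise only the values \<open>\<Gamma> i j\<close> with \<open>i, j \<ge> 1\<close> and \<open>\<phi> i j k\<close> (for
  $\varphi_{i,j;k}$) with \<open>1 \<le> i < j\<close>, \<open>k \<ge> 1\<close> matter.  A family of functions of time is
  \<open>\<psi> i t\<close>, so that its state at time \<open>t\<close> is \<open>\<lambda>i. \<psi> i t\<close>.
\<close>

definition Y1_norm :: "(nat \<Rightarrow> real) \<Rightarrow> real" where
  "Y1_norm u = (\<Sum>\<^sub>\<infinity>i\<in>{1..}. real i * \<bar>u i\<bar>)"

definition Y1 :: "(nat \<Rightarrow> real) set" where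
  "Y1 = {u. (\<lambda>i. real i * \<bar>u i\<bar>) summable_on {1..}}"

definition Y1_plus :: "(nat \<Rightarrow> real) set" where
  "Y1_plus = {u \<in> Y1. \<forall>i\<ge>1. 0 \<le> u i}"

text \<open>Derivative of a function on \<open>[0,\<infinity>)\<close>, one-sided at \<open>0\<close>.\<close>

definition hderiv :: "(real \<Rightarrow> real) \<Rightarrow> real \<Rightarrow> real" where
  "hderiv G x = vector_derivative G (at x within {0..})"

definition C2_halfline :: "(real \<Rightarrow> real) \<Rightarrow> bool" where
  "C2_halfline G \<longleftrightarrow> G differentiable_on {0..} \<and> hderiv G differentiable_on {0..} \<and>
     continuous_on {0..} (hderiv (hderiv G))"

definition G1_class :: "(real \<Rightarrow> real) set" where
  "G1_class = {G. C2_halfline G \<and> (\<forall>x\<ge>0. 0 \<le> G x) \<and> convex_on {0..} G \<and>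
     G 0 = 0 \<and> hderiv G 0 = 0 \<and> concave_on {0..} (hderiv G)}"

definition G1_inf_class :: "(real \<Rightarrow> real) set" where
  "G1_inf_class = {G \<in> G1_class. filterlim (\<lambda>z. (z * hderiv G z - G z) / z) at_top at_top}"

text \<open>
  The space $L^\infty((0,\infty),Y_{1,+})$: Bochner (strong) measurability is almost everywhere
  convergence in \<open>Y\<^sub>1\<close> of a sequence of \<open>Y\<^sub>1\<close>-valued simple functions.
\<close>

definition strongly_measurable_Y1 :: "(real \<Rightarrow> nat \<Rightarrow> real) \<Rightarrow> bool" where
  "strongly_measurable_Y1 u \<longleftrightarrow>
     (\<exists>s :: nat \<Rightarrow> real \<Rightarrow> nat \<Rightarrow> real.
        (\<forall>n. simple_function (lebesgue_on {0<..}) (s n) \<and> (\<forall>t>0. s n t \<in> Y1)) \<and>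
        (AE t in lebesgue_on {0<..}. (\<lambda>n. Y1_norm (\<lambda>i. s n t i - u t i)) \<longlonglongrightarrow> 0))"

definition Linf_Y1_plus :: "(real \<Rightarrow> nat \<Rightarrow> real) set" where
  "Linf_Y1_plus = {u. (\<forall>t>0. u t \<in> Y1_plus) \<and> strongly_measurable_Y1 u \<and>
     (\<exists>C. AE t in lebesgue_on {0<..}. Y1_norm (u t) \<le> C)}"

text \<open>
  All terms of the two series below are non-negative, so they are formed in \<open>[0,\<infinity>]\<close>; they may be
  infinite at individual times.
\<close>

definition gain :: "(nat \<Rightarrow> nat \<Rightarrow> nat \<Rightarrow> real) \<Rightarrow> (nat \<Rightarrow> nat \<Rightarrow> real) \<Rightarrow> (nat \<Rightarrow> real) \<Rightarrow> nat \<Rightarrow> ennreal"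
  where "gain \<phi> \<Gamma> u i =
     (\<Sum>\<^sub>\<infinity>j\<in>{i+1..}. \<Sum>\<^sub>\<infinity>k\<in>{1..}. ennreal (\<phi> i j k * \<Gamma> j k * u j * u k))"

definition loss :: "(nat \<Rightarrow> nat \<Rightarrow> real) \<Rightarrow> (nat \<Rightarrow> real) \<Rightarrow> nat \<Rightarrow> ennreal" where
  "loss \<Gamma> u i = (\<Sum>\<^sub>\<infinity>j\<in>{1..}. ennreal (\<Gamma> i j * u i * u j))"

definition L1_nonneg :: "real \<Rightarrow> (real \<Rightarrow> ennreal) \<Rightarrow> bool" where
  "L1_nonneg t f \<longleftrightarrow> f \<in> borel_measurable (lebesgue_on {0<..<t}) \<and>
     (\<integral>\<^sup>+ s. f s \<partial>lebesgue_on {0<..<t}) < \<infinity>"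

text \<open>
  The \<^const>\<open>enn2real\<close> below is only applied to integrals that the preceding conjuncts make finite.
\<close>

definition global_mild_solution ::
  "(nat \<Rightarrow> nat \<Rightarrow> nat \<Rightarrow> real) \<Rightarrow> (nat \<Rightarrow> nat \<Rightarrow> real) \<Rightarrow> (nat \<Rightarrow> real) \<Rightarrow> (nat \<Rightarrow> real \<Rightarrow> real) \<Rightarrow> bool"
  where "global_mild_solution \<phi> \<Gamma> \<psi>in \<psi> \<longleftrightarrow>
     (\<forall>i\<ge>1. \<forall>t\<ge>0. 0 \<le> \<psi> i t) \<and>
     (\<lambda>t i. \<psi> i t) \<in> Linf_Y1_plus \<and>
     (\<forall>i\<ge>1. \<forall>t>0.
        continuous_on {0..} (\<psi> i) \<and>
        L1_nonneg t (\<lambda>s. gain \<phi> \<Gamma> (\<lambda>j. \<psi> j s) i) \<and>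
        L1_nonneg t (\<lambda>s. loss \<Gamma> (\<lambda>j. \<psi> j s) i) \<and>
        \<psi> i t = \<psi>in i
          + enn2real (\<integral>\<^sup>+ s. gain \<phi> \<Gamma> (\<lambda>j. \<psi> j s) i \<partial>lebesgue_on {0<..<t})
          - (1 - of_bool (i = 1)) *
              enn2real (\<integral>\<^sup>+ s. loss \<Gamma> (\<lambda>j. \<psi> j s) i \<partial>lebesgue_on {0<..<t}))"

end

theory Submission
  imports Defs "HOL-Complex_Analysis.Great_Picard"
begin

text \<open>
  The solution is a limit of explicit Euler schemes for the system truncated to sizes at most \<open>n\<close>,
  with step sizes so small that the iterates stay non-negative.  If \<open>\<Lambda> i / i\<close> is non-decreasing, the
  moment \<open>\<Sum>i. \<Lambda> i * u i\<close> decreases along the scheme, and the decrease equals the time sum of a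
  non-negative quadratic form in \<open>u\<close>.  For \<open>\<Lambda> i = i\<close> cut off below \<open>r\<close> this bounds the fragments of
  size less than \<open>r\<close> produced by particles of size at least \<open>r\<close> by the initial mass of the tail.  For
  \<open>\<Lambda> i = G\<^sub>0 i\<close> the form dominates \<open>w j * \<Gamma> j k * u j * u k\<close> with
  \<open>w j = j * (G\<^sub>0 j / j - G\<^sub>0 (j - 1) / (j - 1))\<close>, which tends to infinity, so collisions involving a
  large particle are uniformly rare.  Hence the gain and loss series have uniformly small tails in
  time average.  This yields equicontinuity, a pointwise convergent subsequence, and convergence of
  the gain and loss integrals.
\<close>

section \<open>Quadratic forms\<close>

text \<open>The obstacle is that \<open>\<Gamma>\<close> obeys no growth condition. At a fixed time
  the mass gives no bound, uniform in \<open>n\<close>, on \<open>\<Gamma> j k * u j * u k\<close>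
  summed over large sizes. Only the accumulated dissipation does, so every tail bound on the rates
  concerns sums over time steps. One weight is not enough for the gain: \<open>\<phi> i j k\<close>
  may be as large as \<open>j / i\<close>, so a bound on the collision rate need not control the
  number of fragments of large \<open>j\<close>, whereas the mass leaving a tail counts these
  fragments directly. Compactness is sought for each size separately, and only in a weak form: for
  each tolerance \<epsilon> there is a Lipschitz constant valid up to the error \<epsilon>. Euler
  steps keep the approximation to finite sums with exact identities, so no existence theory for
  differential equations enters. The rates are kept as coefficient arrays \<open>a\<close> in
  \<open>quad a N u\<close>: comparing rates becomes comparing entries, and restricting sizes
  becomes changing the array.\<close>

definition quad :: "(nat \<Rightarrow> nat \<Rightarrow> real) \<Rightarrow> nat \<Rightarrow> (nat \<Rightarrow> real) \<Rightarrow> real" where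
  "quad a N u = (\<Sum>j=1..N. \<Sum>k=1..N. a j k * u j * u k)"

lemma sum_quad: "(\<Sum>i\<in>I. c i * quad (a i) N u) = quad (\<lambda>j k. \<Sum>i\<in>I. c i * a i j k) N u"
proof -
  have "(\<Sum>i\<in>I. c i * quad (a i) N u) = (\<Sum>i\<in>I. \<Sum>j=1..N. \<Sum>k=1..N. c i * a i j k * u j * u k)"
    by (simp add: quad_def sum_distrib_left mult.assoc)
  also have "\<dots> = (\<Sum>j=1..N. \<Sum>i\<in>I. \<Sum>k=1..N. c i * a i j k * u j * u k)"
    by (rule sum.swap)
  also have "\<dots> = (\<Sum>j=1..N. \<Sum>k=1..N. \<Sum>i\<in>I. c i * a i j k * u j * u k)"
    by (intro sum.cong refl sum.swap)
  also have "\<dots> = quad (\<lambda>j k. \<Sum>i\<in>I. c i * a i j k) N u"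
    by (simp add: quad_def sum_distrib_right)
  finally show ?thesis .
qed

lemma quad_cong:
  assumes "\<And>j k. 1 \<le> j \<Longrightarrow> j \<le> N \<Longrightarrow> 1 \<le> k \<Longrightarrow> k \<le> N \<Longrightarrow> a j k = b j k"
  shows "quad a N u = quad b N u"
  unfolding quad_def using assms by (intro sum.cong refl) auto

lemma quad_mono:
  assumes "\<And>j k. 1 \<le> j \<Longrightarrow> j \<le> N \<Longrightarrow> 1 \<le> k \<Longrightarrow> k \<le> N \<Longrightarrow> a j k \<le> b j k"
    and "\<And>j. 1 \<le> j \<Longrightarrow> 0 \<le> u j"
  shows "quad a N u \<le> quad b N u"
  unfolding quad_def using assms by (intro sum_mono mult_right_mono) auto

lemma quad_nonneg:
  assumes "\<And>j k. 1 \<le> j \<Longrightarrow> 1 \<le> k \<Longrightarrow> 0 \<le> a j k" "\<And>j. 1 \<le> j \<Longrightarrow> 0 \<le> u j"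
  shows "0 \<le> quad a N u"
  unfolding quad_def using assms by (intro sum_nonneg) auto

lemma quad_add: "quad (\<lambda>j k. a j k + b j k) N u = quad a N u + quad b N u"
  by (simp add: quad_def sum.distrib distrib_right)

lemma quad_diff: "quad (\<lambda>j k. a j k - b j k) N u = quad a N u - quad b N u"
  by (simp add: quad_def sum_subtractf left_diff_distrib)

lemma quad_cmult: "quad (\<lambda>j k. c * a j k) N u = c * quad a N u"
  by (simp add: quad_def sum_distrib_left mult.assoc)

lemma quad_zero: "quad (\<lambda>j k. 0) N u = 0"
  by (simp add: quad_def)

lemma quad_transpose: "quad (\<lambda>j k. a k j) N u = quad a N u"
  unfolding quad_def by (subst sum.swap) (simp add: mult.commute mult.left_commute)

lemma quad_row: "quad (\<lambda>j k. if j = i then b k else 0) N u =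
    (if 1 \<le> i \<and> i \<le> N then u i * (\<Sum>k=1..N. b k * u k) else 0)"
proof -
  have "quad (\<lambda>j k. if j = i then b k else 0) N u
      = (\<Sum>j=1..N. if j = i then u i * (\<Sum>k=1..N. b k * u k) else 0)"
    unfolding quad_def by (intro sum.cong refl) (auto simp: sum_distrib_left algebra_simps)
  then show ?thesis by simp
qed

lemma quad_bounded:
  assumes "\<And>j k. 1 \<le> j \<Longrightarrow> 1 \<le> k \<Longrightarrow> 0 \<le> a j k" "\<And>j. 1 \<le> j \<Longrightarrow> 0 \<le> u j \<and> u j \<le> M"
  shows "quad a N u \<le> M\<^sup>2 * (\<Sum>j=1..N. \<Sum>k=1..N. a j k)"
proof -
  have "a j k * u j * u k \<le> M\<^sup>2 * a j k" if "1 \<le> j" "1 \<le> k" for j k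
  proof -
    have "u j * u k \<le> M * M"
      using assms(2)[OF that(1)] assms(2)[OF that(2)] by (intro mult_mono) auto
    then have "a j k * (u j * u k) \<le> a j k * (M * M)"
      using assms(1)[OF that] by (intro mult_left_mono)
    then show ?thesis by (simp add: power2_eq_square mult_ac)
  qed
  then show ?thesis
    unfolding quad_def sum_distrib_left by (intro sum_mono) auto
qed

lemma quad_subset:
  assumes "R \<le> P"
  shows "quad a R u = quad (\<lambda>j k. of_bool (j \<le> R \<and> k \<le> R) * a j k) P u"
proof -
  have "quad a R u = (\<Sum>j=1..R. \<Sum>k=1..P. of_bool (j \<le> R \<and> k \<le> R) * a j k * u j * u k)"
    unfolding quad_def using assms
    by (intro sum.cong[OF refl] sum.mono_neutral_cong_left) auto
  also have "\<dots> = quad (\<lambda>j k. of_bool (j \<le> R \<and> k \<le> R) * a j k) P u"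
    unfolding quad_def using assms by (intro sum.mono_neutral_left) (auto intro!: sum.neutral)
  finally show ?thesis .
qed

lemma quad_support:
  assumes "\<And>j. n < j \<Longrightarrow> u j = 0" "n \<le> P"
  shows "quad a n u = quad a P u"
proof -
  have "of_bool (j \<le> n \<and> k \<le> n) * a j k * u j * u k = a j k * u j * u k" for j k
    using assms(1)[of j] assms(1)[of k] by (cases "j \<le> n"; cases "k \<le> n") auto
  then show ?thesis by (simp only: quad_subset[OF assms(2)]) (simp only: quad_def)
qed

lemma quad_split:
  assumes "\<And>j. n < j \<Longrightarrow> u j = 0"
  shows "quad a n u = quad (\<lambda>j k. of_bool (R < j \<or> R < k) * a j k) n u + quad a R u"
proof -
  \<comment> \<open>\<open>R\<close> stays fixed while \<open>n\<close> varies, so either may be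
    larger; both forms are compared on a common square.\<close>
  let ?P = "max n R"
  have sup: "quad b n u = quad b ?P u" for b
    by (rule quad_support) (auto simp: assms)
  have "quad a n u = quad (\<lambda>j k. of_bool (R < j \<or> R < k) * a j k + of_bool (j \<le> R \<and> k \<le> R) * a j k) ?P u"
    unfolding sup by (intro quad_cong) auto
  also have "\<dots> = quad (\<lambda>j k. of_bool (R < j \<or> R < k) * a j k) n u + quad a R u"
    unfolding quad_add quad_subset[of R ?P, simplified] sup by simp
  finally show ?thesis .
qed

section \<open>The truncated Euler scheme\<close>

text \<open>The weights whose moments do not increase under breakage.\<close>

definition slope_mono :: "(nat \<Rightarrow> real) \<Rightarrow> bool" where
  "slope_mono \<Lambda> \<longleftrightarrow> (\<forall>i\<ge>1. 0 \<le> \<Lambda> i) \<and> (\<forall>i j. 1 \<le> i \<and> i \<le> j \<longrightarrow> \<Lambda> i / real i \<le> \<Lambda> j / real j)"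

lemma slope_mono_cut: "slope_mono \<Lambda> \<Longrightarrow> slope_mono (\<lambda>i. of_bool (r \<le> i) * \<Lambda> i)"
  by (auto simp: slope_mono_def)

lemma slope_mono_real: "slope_mono real"
  by (auto simp: slope_mono_def)

text \<open>\<open>\<Lambda>0 i\<close> stands for \<open>G0 (real i)\<close>. The last assumption
  is a discrete form of the growth condition in \<open>G1_inf_class\<close>, because
  \<open>(z * G' z - G z) / z\<close> is \<open>z\<close> times the derivative of
  \<open>G z / z\<close>.\<close>

locale breakage =
  fixes \<Gamma> :: "nat \<Rightarrow> nat \<Rightarrow> real"
    and \<phi> :: "nat \<Rightarrow> nat \<Rightarrow> nat \<Rightarrow> real"
    and \<psi>in :: "nat \<Rightarrow> real"
    and \<Lambda>0 :: "nat \<Rightarrow> real"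
  assumes \<Gamma>_nonneg: "1 \<le> i \<Longrightarrow> 1 \<le> j \<Longrightarrow> 0 \<le> \<Gamma> i j"
    and \<Gamma>_sym: "1 \<le> i \<Longrightarrow> 1 \<le> j \<Longrightarrow> \<Gamma> i j = \<Gamma> j i"
    and \<phi>_nonneg: "1 \<le> i \<Longrightarrow> i < j \<Longrightarrow> 1 \<le> k \<Longrightarrow> 0 \<le> \<phi> i j k"
    and \<phi>_mass: "2 \<le> j \<Longrightarrow> 1 \<le> k \<Longrightarrow> (\<Sum>i=1..<j. real i * \<phi> i j k) = real j"
    and \<psi>in_nonneg: "1 \<le> i \<Longrightarrow> 0 \<le> \<psi>in i"
    and \<psi>in_summable: "(\<lambda>i. real i * \<psi>in i) summable_on {1..}"
    and \<Lambda>0: "slope_mono \<Lambda>0"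
    and \<Lambda>0_summable: "(\<lambda>i. \<Lambda>0 i * \<psi>in i) summable_on {1..}"
    and \<Lambda>0_superlinear:
      "filterlim (\<lambda>j. real j * (\<Lambda>0 j / real j - \<Lambda>0 (j - 1) / real (j - 1))) at_top sequentially"
begin

text \<open>The case distinction extends the gain to all \<open>j\<close>, so that gain and loss are
  quadratic forms on the same square.\<close>

definition gain_coeff :: "nat \<Rightarrow> nat \<Rightarrow> nat \<Rightarrow> real" where
  "gain_coeff i j k = (if i < j then \<phi> i j k * \<Gamma> j k else 0)"

definition loss_coeff :: "nat \<Rightarrow> nat \<Rightarrow> nat \<Rightarrow> real" where
  "loss_coeff i j k = (if j = i then \<Gamma> i k else 0)"

definition net_coeff :: "nat \<Rightarrow> nat \<Rightarrow> nat \<Rightarrow> real" where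
  "net_coeff i j k = gain_coeff i j k - of_bool (i \<noteq> 1) * loss_coeff i j k"

text \<open>Amount of the \<Lambda>-moment destroyed per unit of time when \<open>j\<close> breaks
  on meeting \<open>k\<close>: its own weight minus that of its fragments. It is zero for
  \<open>j = 1\<close> because monomers do not break.\<close>

definition dissipation :: "(nat \<Rightarrow> real) \<Rightarrow> nat \<Rightarrow> nat \<Rightarrow> real" where
  "dissipation \<Lambda> j k = (if j = 1 then 0 else (\<Lambda> j - (\<Sum>i=1..<j. \<Lambda> i * \<phi> i j k)) * \<Gamma> j k)"

definition mass :: real where "mass = (\<Sum>\<^sub>\<infinity>i\<in>{1..}. real i * \<psi>in i)"

text \<open>The step size makes the loss in one Euler step at most the amount present.\<close>

definition h :: "nat \<Rightarrow> real" where
  "h n = 1 / ((real n + 1) * (1 + mass * (\<Sum>i=1..n. \<Sum>j=1..n. \<Gamma> i j)))"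

text \<open>Fragments are smaller than their parent, so the sizes up to \<open>n\<close> are closed
  under breakage and the cut-off loses no mass.\<close>

primrec euler :: "nat \<Rightarrow> nat \<Rightarrow> nat \<Rightarrow> real" where
  "euler n 0 = (\<lambda>i. if 1 \<le> i \<and> i \<le> n then \<psi>in i else 0)"
| "euler n (Suc m) = (\<lambda>i. if 1 \<le> i \<and> i \<le> n
      then euler n m i + h n * quad (net_coeff i) n (euler n m) else 0)"

section \<open>Dissipation of moments by breakage\<close>

lemma gain_coeff_nonneg: "1 \<le> i \<Longrightarrow> 1 \<le> j \<Longrightarrow> 1 \<le> k \<Longrightarrow> 0 \<le> gain_coeff i j k"
  by (simp add: gain_coeff_def \<Gamma>_nonneg \<phi>_nonneg)

lemma loss_coeff_nonneg: "1 \<le> i \<Longrightarrow> 1 \<le> j \<Longrightarrow> 1 \<le> k \<Longrightarrow> 0 \<le> loss_coeff i j k"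
  by (simp add: loss_coeff_def \<Gamma>_nonneg)

lemma quad_net: "quad (net_coeff i) N u
    = quad (gain_coeff i) N u - of_bool (i \<noteq> 1) * quad (loss_coeff i) N u"
  unfolding net_coeff_def by (simp add: quad_diff quad_cmult)

text \<open>The fragments have total mass \<open>j\<close>, so \<open>\<Lambda> j\<close> can be
  distributed over them in proportion to their masses. Each fragment then loses its mass times the
  drop of the slope \<open>\<Lambda> i / i\<close>, which explains the monotonicity required in
  \<open>slope_mono\<close>.\<close>

lemma dissipation_eq:
  assumes "2 \<le> j" "1 \<le> k"
  shows "\<Lambda> j - (\<Sum>i=1..<j. \<Lambda> i * \<phi> i j k)
    = (\<Sum>i=1..<j. real i * \<phi> i j k * (\<Lambda> j / real j - \<Lambda> i / real i))"
proof -
  have "(\<Sum>i=1..<j. real i * \<phi> i j k * (\<Lambda> j / real j - \<Lambda> i / real i))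
      = (\<Sum>i=1..<j. (\<Lambda> j / real j) * (real i * \<phi> i j k) - \<Lambda> i * \<phi> i j k)"
    by (intro sum.cong refl) (auto simp: field_simps)
  also have "\<dots> = (\<Lambda> j / real j) * real j - (\<Sum>i=1..<j. \<Lambda> i * \<phi> i j k)"
    unfolding sum_subtractf sum_distrib_left[symmetric] using \<phi>_mass[OF assms] by simp
  finally show ?thesis using assms by simp
qed

text \<open>Every fragment has size at most \<open>j - 1\<close>, so its slope drops at least by the
  last increment; the total fragment mass supplies the factor \<open>j\<close>.\<close>

lemma dissipation_ge:
  assumes \<Lambda>: "slope_mono \<Lambda>" and "2 \<le> j" "1 \<le> k"
  shows "real j * (\<Lambda> j / real j - \<Lambda> (j - 1) / real (j - 1)) * \<Gamma> j k \<le> dissipation \<Lambda> j k"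
proof -
  have "real j * (\<Lambda> j / real j - \<Lambda> (j - 1) / real (j - 1))
      = (\<Sum>i=1..<j. real i * \<phi> i j k * (\<Lambda> j / real j - \<Lambda> (j - 1) / real (j - 1)))"
    unfolding sum_distrib_right[symmetric] \<phi>_mass[OF assms(2,3)] ..
  also have "\<dots> \<le> (\<Sum>i=1..<j. real i * \<phi> i j k * (\<Lambda> j / real j - \<Lambda> i / real i))"
  proof (intro sum_mono mult_left_mono)
    fix i assume i: "i \<in> {1..<j}"
    then have "\<Lambda> i / real i \<le> \<Lambda> (j - 1) / real (j - 1)"
      using \<Lambda> unfolding slope_mono_def by (metis Suc_diff_1 assms(2) atLeastLessThan_iff
          less_Suc_eq_le order_less_le_trans zero_less_numeral)
    then show "\<Lambda> j / real j - \<Lambda> (j - 1) / real (j - 1) \<le> \<Lambda> j / real j - \<Lambda> i / real i" by simp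
    show "0 \<le> real i * \<phi> i j k" using i assms by (simp add: \<phi>_nonneg)
  qed
  also have "\<dots> = \<Lambda> j - (\<Sum>i=1..<j. \<Lambda> i * \<phi> i j k)"
    using dissipation_eq[OF assms(2,3)] by simp
  finally show ?thesis
    unfolding dissipation_def using assms by (simp add: \<Gamma>_nonneg mult_right_mono)
qed

lemma dissipation_nonneg:
  assumes \<Lambda>: "slope_mono \<Lambda>" and "1 \<le> j" "1 \<le> k"
  shows "0 \<le> dissipation \<Lambda> j k"
proof (cases "j = 1")
  case False
  with assms have j: "2 \<le> j" by simp
  then have "1 \<le> j - 1 \<and> j - 1 \<le> j" by simp
  then have "0 \<le> real j * (\<Lambda> j / real j - \<Lambda> (j - 1) / real (j - 1)) * \<Gamma> j k"
    using \<Lambda> unfolding slope_mono_def using assms \<Gamma>_nonneg by (metis diff_ge_0_iff_ge mult_nonneg_nonneg of_nat_0_le_iff)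
  then show ?thesis using dissipation_ge[OF \<Lambda> j assms(3)] by linarith
qed (simp add: dissipation_def)

text \<open>The cut-off weight has slope 1 from \<open>r\<close> on and 0 below, so its dissipation
  is the fragment mass that falls below \<open>r\<close>. A fragment of size \<open>i\<close>
  contributes \<open>i >= 1\<close> to this mass, hence the number of such fragments is bounded as
  well.\<close>

lemma dissipation_tail:
  assumes "1 \<le> i" "i < r" "1 \<le> j" "1 \<le> k"
  shows "of_bool (r \<le> j) * gain_coeff i j k \<le> dissipation (\<lambda>i. of_bool (r \<le> i) * real i) j k"
proof (cases "r \<le> j")
  case True
  have j: "2 \<le> j" using assms True by simp
  let ?\<Lambda> = "\<lambda>i. of_bool (r \<le> i) * real i"
  have "\<phi> i j k \<le> real i * \<phi> i j k"
    using assms True \<phi>_nonneg[of i j k] by (simp add: mult_le_cancel_right1)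
  also have "\<dots> = real i * \<phi> i j k * (?\<Lambda> j / real j - ?\<Lambda> i / real i)"
    using assms True by simp
  also have "\<dots> \<le> (\<Sum>i=1..<j. real i * \<phi> i j k * (?\<Lambda> j / real j - ?\<Lambda> i / real i))"
    using assms True by (intro member_le_sum) (auto simp: \<phi>_nonneg)
  also have "\<dots> = ?\<Lambda> j - (\<Sum>i=1..<j. ?\<Lambda> i * \<phi> i j k)"
    using dissipation_eq[OF j assms(4), of ?\<Lambda>] by simp
  finally have "\<phi> i j k * \<Gamma> j k \<le> (?\<Lambda> j - (\<Sum>i=1..<j. ?\<Lambda> i * \<phi> i j k)) * \<Gamma> j k"
    using assms by (intro mult_right_mono) (auto simp: \<Gamma>_nonneg)
  then show ?thesis using assms True j by (simp add: gain_coeff_def dissipation_def)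
next
  case False
  then show ?thesis using dissipation_nonneg[OF slope_mono_cut[OF slope_mono_real]] assms by simp
qed

text \<open>The system tested with \<Lambda>: for \<open>j <= n\<close> all fragments of
  \<open>j\<close> lie in the truncation, so summing over \<open>i\<close> leaves exactly the weight
  of the parent minus that of its fragments.\<close>

lemma sum_net: "(\<Sum>i=1..n. \<Lambda> i * quad (net_coeff i) n u) = - quad (dissipation \<Lambda>) n u"
proof -
  have "(\<Sum>i=1..n. \<Lambda> i * net_coeff i j k) = - 1 * dissipation \<Lambda> j k" if "1 \<le> j" "j \<le> n" for j k
  proof -
    have "(\<Sum>i=1..n. \<Lambda> i * gain_coeff i j k) = (\<Sum>i=1..<j. \<Lambda> i * \<phi> i j k * \<Gamma> j k)"
      using that by (intro sum.mono_neutral_cong_right) (auto simp: gain_coeff_def)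
    moreover have "(\<Sum>i=1..n. \<Lambda> i * (of_bool (i \<noteq> 1) * loss_coeff i j k))
        = (\<Sum>i=1..n. if i = j then of_bool (j \<noteq> 1) * \<Lambda> j * \<Gamma> j k else 0)"
      by (intro sum.cong) (auto simp: loss_coeff_def)
    ultimately show ?thesis using that
      by (simp add: net_coeff_def right_diff_distrib sum_subtractf dissipation_def left_diff_distrib
          sum_distrib_right)
  qed
  then have "(\<Sum>i=1..n. \<Lambda> i * quad (net_coeff i) n u) = quad (\<lambda>j k. - 1 * dissipation \<Lambda> j k) n u"
    unfolding sum_quad by (intro quad_cong) auto
  then show ?thesis unfolding quad_cmult by simp
qed

section \<open>Mass and positivity of the scheme\<close>

lemma euler_support: "\<not> (1 \<le> i \<and> i \<le> n) \<Longrightarrow> euler n m i = 0"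
  by (cases m) auto

lemma mass_nonneg: "0 \<le> mass"
  unfolding mass_def by (intro infsum_nonneg) (simp add: \<psi>in_nonneg)

lemma sum_le_mass: "(\<Sum>i=1..n. real i * \<psi>in i) \<le> mass"
  unfolding mass_def by (intro finite_sum_le_infsum \<psi>in_summable) (auto simp: \<psi>in_nonneg)

lemma \<Gamma>_sum_nonneg: "0 \<le> (\<Sum>i=1..n. \<Sum>j=1..n. \<Gamma> i j)"
  by (intro sum_nonneg) (auto simp: \<Gamma>_nonneg)

lemma h_pos: "0 < h n"
proof -
  have "0 \<le> mass * (\<Sum>i=1..n. \<Sum>j=1..n. \<Gamma> i j)"
    using mass_nonneg \<Gamma>_sum_nonneg by simp
  then show ?thesis unfolding h_def by (intro divide_pos_pos mult_pos_pos) auto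
qed

lemma h_le: "h n \<le> 1 / (real n + 1)"
proof -
  have "0 \<le> mass * (\<Sum>i=1..n. \<Sum>j=1..n. \<Gamma> i j)"
    using mass_nonneg \<Gamma>_sum_nonneg by simp
  then have "real n + 1 \<le> (real n + 1) * (1 + mass * (\<Sum>i=1..n. \<Sum>j=1..n. \<Gamma> i j))"
    by (simp add: mult_le_cancel_left1)
  then show ?thesis unfolding h_def by (intro divide_left_mono) auto
qed

text \<open>This is the purpose of the factor \<open>real n + 1\<close> in \<open>h\<close>;
  positivity needs only the other factor.\<close>

lemma h_tendsto: "h \<longlonglongrightarrow> 0"
proof (rule tendsto_sandwich[where f = "\<lambda>_. 0" and h = "\<lambda>n. 1 / (real n + 1)"])
  show "(\<lambda>n. 1 / (real n + 1)) \<longlonglongrightarrow> 0"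
    using LIMSEQ_inverse_real_of_nat by (simp add: inverse_eq_divide add.commute)
qed (use h_pos h_le in \<open>auto intro!: always_eventually less_imp_le\<close>)

lemma h_mass: "h n * (mass * (\<Sum>i=1..n. \<Sum>j=1..n. \<Gamma> i j)) \<le> 1"
proof -
  let ?S = "mass * (\<Sum>i=1..n. \<Sum>j=1..n. \<Gamma> i j)"
  have S: "0 \<le> ?S" using mass_nonneg \<Gamma>_sum_nonneg by simp
  have "1 * (1 + ?S) \<le> (real n + 1) * (1 + ?S)"
    using S by (intro mult_right_mono) auto
  then have "?S \<le> (real n + 1) * (1 + ?S)" by simp
  then show ?thesis using S unfolding h_def by (simp add: divide_le_eq)
qed

lemma sum_euler_Suc: "(\<Sum>i=1..n. \<Lambda> i * euler n (Suc m) i)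
    = (\<Sum>i=1..n. \<Lambda> i * euler n m i) - h n * quad (dissipation \<Lambda>) n (euler n m)"
proof -
  have "(\<Sum>i=1..n. \<Lambda> i * euler n (Suc m) i)
      = (\<Sum>i=1..n. \<Lambda> i * euler n m i + h n * (\<Lambda> i * quad (net_coeff i) n (euler n m)))"
    by (intro sum.cong refl) (auto simp: algebra_simps)
  then show ?thesis
    by (simp only: sum.distrib sum_distrib_left[symmetric] sum_net)
qed

text \<open>The dissipation of the weight \<open>real\<close> vanishes. No sign of the iterates is
  used, so the identity is available inside the positivity induction that follows.\<close>

lemma euler_mass_eq: "(\<Sum>i=1..n. real i * euler n m i) = (\<Sum>i=1..n. real i * \<psi>in i)"
proof (induction m)
  case 0
  show ?case by (intro sum.cong) auto
next
  case (Suc m)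
  have "quad (dissipation real) n (euler n m) = quad (\<lambda>j k. 0) n (euler n m)"
    by (intro quad_cong) (use \<phi>_mass in \<open>simp add: dissipation_def\<close>)
  then show ?case using Suc sum_euler_Suc[of real n m] by (simp add: quad_zero)
qed

text \<open>The two bounds are proved together: the upper bound at step \<open>m\<close> limits the
  loss rate and gives positivity at step \<open>m + 1\<close>, and positivity with exact mass gives
  the upper bound again.\<close>

lemma euler_nonneg_le: "0 \<le> euler n m i \<and> euler n m i \<le> mass"
proof (induction m arbitrary: i)
  have le: "euler n m i \<le> mass" if nn: "\<And>i. 0 \<le> euler n m i" for i m
  proof (cases "1 \<le> i \<and> i \<le> n")
    case True
    have "euler n m i \<le> real i * euler n m i"
      using True nn[of i] by (simp add: mult_le_cancel_right1)
    also have "\<dots> \<le> (\<Sum>i=1..n. real i * euler n m i)"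
      using True by (intro member_le_sum) (auto simp: nn)
    also have "\<dots> \<le> mass" unfolding euler_mass_eq by (rule sum_le_mass)
    finally show ?thesis .
  next
    case False
    then show ?thesis using euler_support mass_nonneg by simp
  qed
  {
    case 0
    have "0 \<le> euler n 0 i" for i by (simp add: \<psi>in_nonneg)
    then show ?case using le[of 0] by simp
  next
    case (Suc m)
    have "0 \<le> euler n (Suc m) i" for i
    proof (cases "1 \<le> i \<and> i \<le> n")
      case True
      let ?u = "euler n m"
      have L: "quad (loss_coeff i) n ?u = ?u i * (\<Sum>k=1..n. \<Gamma> i k * ?u k)"
        using quad_row[of i "\<Gamma> i"] True by (simp add: loss_coeff_def[abs_def])
      \<comment> \<open>The loss rate per particle of size \<open>i\<close>; \<open>h n\<close>
        times it is at most 1 by \<open>h_mass\<close>.\<close>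
      have "(\<Sum>k=1..n. \<Gamma> i k * ?u k) \<le> (\<Sum>k=1..n. \<Gamma> i k * mass)"
        using Suc True by (intro sum_mono mult_left_mono) (auto simp: \<Gamma>_nonneg)
      also have "\<dots> = mass * (\<Sum>k=1..n. \<Gamma> i k)" by (simp add: sum_distrib_left mult.commute)
      also have "(\<Sum>k=1..n. \<Gamma> i k) \<le> (\<Sum>i=1..n. \<Sum>k=1..n. \<Gamma> i k)"
        using True by (intro member_le_sum[of i]) (auto intro!: sum_nonneg simp: \<Gamma>_nonneg)
      finally have "(\<Sum>k=1..n. \<Gamma> i k * ?u k) \<le> mass * (\<Sum>i=1..n. \<Sum>k=1..n. \<Gamma> i k)"
        using mass_nonneg by (simp add: mult_left_mono)
      then have "h n * (\<Sum>k=1..n. \<Gamma> i k * ?u k) \<le> 1"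
        using h_pos[of n] h_mass[of n] by (meson less_imp_le mult_left_mono order_trans)
      then have "?u i * (h n * (\<Sum>k=1..n. \<Gamma> i k * ?u k)) \<le> ?u i * 1"
        using Suc by (intro mult_left_mono) auto
      then have 1: "h n * quad (loss_coeff i) n ?u \<le> ?u i" unfolding L by (simp add: mult_ac)
      have "0 \<le> quad (gain_coeff i) n ?u" "0 \<le> quad (loss_coeff i) n ?u"
        using Suc True by (auto intro!: quad_nonneg simp: gain_coeff_nonneg loss_coeff_nonneg)
      then have 2: "0 \<le> h n * quad (gain_coeff i) n ?u" "0 \<le> h n * quad (loss_coeff i) n ?u"
        using h_pos[of n] by auto
      show ?thesis using True 1 2 Suc[of i] by (cases "i = 1") (auto simp: quad_net right_diff_distrib)
    qed auto
    then show ?case using le[of "Suc m"] by simp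
  }
qed

lemma euler_nonneg: "0 \<le> euler n m i" and euler_le_mass: "euler n m i \<le> mass"
  using euler_nonneg_le by auto

section \<open>Riemann sums in time and the moment identity\<close>

definition timesum :: "(nat \<Rightarrow> nat \<Rightarrow> real) \<Rightarrow> nat \<Rightarrow> nat \<Rightarrow> real" where
  "timesum a n m = h n * (\<Sum>l<m. quad a n (euler n l))"

lemma timesum_mono:
  assumes "\<And>j k. 1 \<le> j \<Longrightarrow> 1 \<le> k \<Longrightarrow> a j k \<le> b j k"
  shows "timesum a n m \<le> timesum b n m"
  unfolding timesum_def using h_pos[of n] assms
  by (intro mult_left_mono sum_mono quad_mono) (auto simp: euler_nonneg)

lemma timesum_nonneg:
  assumes "\<And>j k. 1 \<le> j \<Longrightarrow> 1 \<le> k \<Longrightarrow> 0 \<le> a j k"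
  shows "0 \<le> timesum a n m"
  using timesum_mono[of "\<lambda>_ _. 0" a n m] assms by (simp add: timesum_def quad_zero)

lemma timesum_add: "timesum (\<lambda>j k. a j k + b j k) n m = timesum a n m + timesum b n m"
  by (simp add: timesum_def quad_add sum.distrib distrib_left)

lemma timesum_cmult: "timesum (\<lambda>j k. c * a j k) n m = c * timesum a n m"
  by (simp add: timesum_def quad_cmult sum_distrib_left[symmetric])

lemma timesum_transpose: "timesum (\<lambda>j k. a k j) n m = timesum a n m"
  by (simp add: timesum_def quad_transpose[of a])

text \<open>Telescoping of \<open>sum_euler_Suc\<close>. For a \<open>slope_mono\<close> weight both
  terms on the left are non-negative, so the initial moment bounds the current moment and the total
  dissipation over any number of steps.\<close>

lemma energy: "(\<Sum>i=1..n. \<Lambda> i * euler n m i) + timesum (dissipation \<Lambda>) n m = (\<Sum>i=1..n. \<Lambda> i * \<psi>in i)"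
proof (induction m)
  case 0
  have "(\<Sum>i=1..n. \<Lambda> i * euler n 0 i) = (\<Sum>i=1..n. \<Lambda> i * \<psi>in i)" by (intro sum.cong) auto
  then show ?case by (simp add: timesum_def)
next
  case (Suc m)
  then show ?case using sum_euler_Suc[of \<Lambda> n m] by (simp add: timesum_def distrib_left)
qed

lemma energy_bounds:
  assumes \<Lambda>: "slope_mono \<Lambda>" and sm: "(\<lambda>i. \<Lambda> i * \<psi>in i) summable_on {r..}" and r: "1 \<le> r"
  shows "(\<Sum>i=r..N. \<Lambda> i * euler n m i) \<le> (\<Sum>\<^sub>\<infinity>i\<in>{r..}. \<Lambda> i * \<psi>in i)"
    and "timesum (dissipation (\<lambda>i. of_bool (r \<le> i) * \<Lambda> i)) n m \<le> (\<Sum>\<^sub>\<infinity>i\<in>{r..}. \<Lambda> i * \<psi>in i)"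
proof -
  let ?L = "\<lambda>i. of_bool (r \<le> i) * \<Lambda> i"
  have nn: "0 \<le> \<Lambda> i" if "r \<le> i" for i using \<Lambda> that r by (simp add: slope_mono_def)
  have "(\<Sum>i=1..n. ?L i * \<psi>in i) = (\<Sum>i=r..n. \<Lambda> i * \<psi>in i)"
    using r by (intro sum.mono_neutral_cong_right) auto
  also have "\<dots> \<le> (\<Sum>\<^sub>\<infinity>i\<in>{r..}. \<Lambda> i * \<psi>in i)"
    using r by (intro finite_sum_le_infsum sm) (auto simp: nn \<psi>in_nonneg)
  finally have *: "(\<Sum>i=1..n. ?L i * \<psi>in i) \<le> (\<Sum>\<^sub>\<infinity>i\<in>{r..}. \<Lambda> i * \<psi>in i)" .
  have d: "0 \<le> timesum (dissipation ?L) n m"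
    by (intro timesum_nonneg dissipation_nonneg slope_mono_cut \<Lambda>)
  have e: "0 \<le> (\<Sum>i=1..n. ?L i * euler n m i)"
    by (intro sum_nonneg) (auto simp: nn euler_nonneg)
  have "(\<Sum>i=r..N. \<Lambda> i * euler n m i) \<le> (\<Sum>i=r..max n N. \<Lambda> i * euler n m i)"
    by (intro sum_mono2) (auto simp: nn euler_nonneg)
  also have "\<dots> = (\<Sum>i=1..n. ?L i * euler n m i)"
    using r by (intro sum.mono_neutral_cong) (auto simp: euler_support)
  finally show "(\<Sum>i=r..N. \<Lambda> i * euler n m i) \<le> (\<Sum>\<^sub>\<infinity>i\<in>{r..}. \<Lambda> i * \<psi>in i)"
    using energy[where \<Lambda> = ?L and n = n and m = m] * d by linarith
  show "timesum (dissipation ?L) n m \<le> (\<Sum>\<^sub>\<infinity>i\<in>{r..}. \<Lambda> i * \<psi>in i)"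
    using energy[where \<Lambda> = ?L and n = n and m = m] * e by linarith
qed

end

section \<open>Uniform tails and equicontinuity\<close>

text \<open>An infinite sum here is a limit along the net of finite subsets; initial segments are
  cofinal in it, so ordinary partial sums converge to the same value.\<close>

lemma filterlim_atLeastLessThan_finite_subsets:
  "filterlim (\<lambda>r. {1..<r}) (finite_subsets_at_top {1::nat..}) sequentially"
  unfolding filterlim_finite_subsets_at_top
proof (intro allI impI)
  fix X :: "nat set" assume X: "finite X \<and> X \<subseteq> {1..}"
  \<comment> \<open>Inserting 0 makes \<open>Max\<close> meaningful for empty
    \<open>X\<close>.\<close>
  have "\<forall>\<^sub>F r in sequentially. Max (insert 0 X) < r" by (rule eventually_gt_at_top)
  then show "\<forall>\<^sub>F r in sequentially. finite {1..<r} \<and> X \<subseteq> {1..<r} \<and> {1..<r} \<subseteq> {1..}"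
  proof eventually_elim
    case (elim r)
    have "x < r" if "x \<in> X" for x
      using elim X Max_ge[of "insert 0 X" x] that by auto
    then show ?case using X by auto
  qed
qed

lemma sum_atLeastAtMost_tendsto_infsum:
  fixes f :: "nat \<Rightarrow> 'a :: {comm_monoid_add, t2_space}"
  assumes "f summable_on {1..}"
  shows "(\<lambda>r. sum f {1..r}) \<longlonglongrightarrow> (\<Sum>\<^sub>\<infinity>i\<in>{1..}. f i)"
proof -
  have "(\<lambda>r. sum f {1..<r}) \<longlonglongrightarrow> (\<Sum>\<^sub>\<infinity>i\<in>{1..}. f i)"
    using has_sum_infsum[OF assms] filterlim_atLeastLessThan_finite_subsets
    unfolding has_sum_def by (rule filterlim_compose)
  then have "(\<lambda>r. sum f {1..<Suc r}) \<longlonglongrightarrow> (\<Sum>\<^sub>\<infinity>i\<in>{1..}. f i)"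
    by (rule LIMSEQ_Suc)
  then show ?thesis by (simp add: atLeastLessThanSuc_atLeastAtMost)
qed

lemma infsum_split_tail:
  fixes f :: "nat \<Rightarrow> real"
  assumes "f summable_on {1..}" "1 \<le> r"
  shows "(\<Sum>\<^sub>\<infinity>i\<in>{1..}. f i) = sum f {1..<r} + (\<Sum>\<^sub>\<infinity>i\<in>{r..}. f i)"
proof -
  have "{1..} = {1..<r} \<union> {r..}" using assms(2) by auto
  moreover have "f summable_on {r..}"
    using assms(1) by (rule summable_on_subset_banach) (use assms(2) in auto)
  moreover have "{1..<r} \<inter> {r..} = {}" by auto
  ultimately show ?thesis
    using infsum_Un_disjoint[OF summable_on_finite[OF finite_atLeastLessThan], of f "{r..}" 1 r] by simp
qed

lemma infsum_tail_tendsto_0: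
  fixes f :: "nat \<Rightarrow> real"
  assumes "f summable_on {1..}"
  shows "(\<lambda>r. \<Sum>\<^sub>\<infinity>i\<in>{r..}. f i) \<longlonglongrightarrow> 0"
proof -
  let ?S = "\<Sum>\<^sub>\<infinity>i\<in>{1..}. f i"
  have "(\<lambda>r. ?S - sum f {1..r}) \<longlonglongrightarrow> ?S - ?S"
    by (intro tendsto_intros sum_atLeastAtMost_tendsto_infsum assms)
  moreover have "?S - sum f {1..r} = (\<Sum>\<^sub>\<infinity>i\<in>{Suc r..}. f i)" for r
    using infsum_split_tail[OF assms, of "Suc r"] by (simp add: atLeastLessThanSuc_atLeastAtMost)
  ultimately have "(\<lambda>r. \<Sum>\<^sub>\<infinity>i\<in>{Suc r..}. f i) \<longlonglongrightarrow> 0" by simp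
  then show ?thesis by (rule LIMSEQ_imp_Suc)
qed

section \<open>Uniform tails of the gain and loss rates\<close>

context breakage
begin

definition tail_mass :: "nat \<Rightarrow> real" where
  "tail_mass r = (\<Sum>\<^sub>\<infinity>i\<in>{r..}. real i * \<psi>in i)"

lemma tail_mass_tendsto: "tail_mass \<longlonglongrightarrow> 0"
  unfolding tail_mass_def[abs_def] by (rule infsum_tail_tendsto_0[OF \<psi>in_summable])

text \<open>A discrete uniform integrability condition. \<open>R\<close> serves all \<open>n\<close>
  and all \<open>m\<close>, hence all time horizons at once: it is obtained from the initial data
  alone.\<close>

definition uniform_tail :: "(nat \<Rightarrow> nat \<Rightarrow> real) \<Rightarrow> bool" where
  "uniform_tail a \<longleftrightarrow>
     (\<forall>\<epsilon>>0. \<exists>R. \<forall>n m. timesum (\<lambda>j k. of_bool (R < j \<or> R < k) * a j k) n m \<le> \<epsilon>)"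

lemma collision_tail:
  assumes "0 < \<epsilon>"
  obtains R where "\<And>n m. timesum (\<lambda>j k. of_bool (R \<le> j) * \<Gamma> j k) n m \<le> \<epsilon>"
proof -
  \<comment> \<open>The cut-off at 1 changes nothing on positive sizes; it gives the form in which
    \<open>energy_bounds\<close> applies with \<open>r = 1\<close>.\<close>
  let ?L = "\<lambda>i. of_bool (1 \<le> i) * \<Lambda>0 i"
  define C where "C = (\<Sum>\<^sub>\<infinity>i\<in>{1..}. \<Lambda>0 i * \<psi>in i)"
  have "0 \<le> C" unfolding C_def using \<Lambda>0
    by (intro infsum_nonneg) (auto simp: slope_mono_def \<psi>in_nonneg)
  \<comment> \<open>Chosen so that \<open>C <= c * \<epsilon>\<close>; the 1 keeps \<open>c\<close>
    positive when \<open>C = 0\<close>.\<close>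
  define c where "c = (C + 1) / \<epsilon>"
  have "0 < c" using \<open>0 \<le> C\<close> assms by (simp add: c_def)
  have "\<forall>\<^sub>F j in sequentially. c \<le> real j * (\<Lambda>0 j / real j - \<Lambda>0 (j - 1) / real (j - 1))"
    using \<Lambda>0_superlinear by (simp add: filterlim_at_top)
  then obtain R where R: "\<And>j. R \<le> j \<Longrightarrow> c \<le> real j * (\<Lambda>0 j / real j - \<Lambda>0 (j - 1) / real (j - 1))"
    by (auto simp: eventually_at_top_linorder)
  \<comment> \<open>Monomers dissipate nothing although \<open>\<Gamma> 1 k\<close> may be positive,
    so \<open>j = 1\<close> is excluded by the maximum with 2.\<close>
  have *: "c * (of_bool (max R 2 \<le> j) * \<Gamma> j k) \<le> dissipation ?L j k" if "1 \<le> j" "1 \<le> k" for j k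
  proof (cases "max R 2 \<le> j")
    case True
    then have "c * \<Gamma> j k \<le> real j * (?L j / real j - ?L (j - 1) / real (j - 1)) * \<Gamma> j k"
      using R[of j] that by (intro mult_right_mono) (auto simp: \<Gamma>_nonneg)
    also have "\<dots> \<le> dissipation ?L j k"
      using True that by (intro dissipation_ge slope_mono_cut \<Lambda>0) auto
    finally show ?thesis using True by simp
  next
    case False
    then have "of_bool (max R 2 \<le> j) = (0 :: real)" by simp
    then show ?thesis using dissipation_nonneg[OF slope_mono_cut[OF \<Lambda>0] that, of 1] by (simp only: mult_zero_left mult_zero_right)
  qed
  have "timesum (\<lambda>j k. of_bool (max R 2 \<le> j) * \<Gamma> j k) n m \<le> \<epsilon>" for n m
  proof -
    have "c * timesum (\<lambda>j k. of_bool (max R 2 \<le> j) * \<Gamma> j k) n m \<le> timesum (dissipation ?L) n m"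
      unfolding timesum_cmult[symmetric] by (intro timesum_mono *)
    also have "\<dots> \<le> C"
      unfolding C_def by (intro energy_bounds \<Lambda>0 \<Lambda>0_summable) simp
    also have "\<dots> \<le> c * \<epsilon>" using assms by (simp add: c_def)
    finally show ?thesis using \<open>0 < c\<close> by simp
  qed
  then show ?thesis by (rule that)
qed

text \<open>The collision tail covers a large first index; a large partner \<open>k\<close> is moved
  to the first place by the symmetry of \<Gamma> and transposition of the form.\<close>

lemma uniform_tail_loss:
  assumes "1 \<le> i"
  shows "uniform_tail (loss_coeff i)"
  unfolding uniform_tail_def
proof (intro allI impI)
  fix \<epsilon> :: real assume "0 < \<epsilon>"
  then obtain R where R: "\<And>n m. timesum (\<lambda>j k. of_bool (R \<le> j) * \<Gamma> j k) n m \<le> \<epsilon> / 2"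
    using collision_tail[of "\<epsilon> / 2"] by auto
  show "\<exists>R. \<forall>n m. timesum (\<lambda>j k. of_bool (R < j \<or> R < k) * loss_coeff i j k) n m \<le> \<epsilon>"
  proof (intro exI allI)
    fix n m
    have "timesum (\<lambda>j k. of_bool (R < j \<or> R < k) * loss_coeff i j k) n m
        \<le> timesum (\<lambda>j k. of_bool (R \<le> j) * \<Gamma> j k + of_bool (R \<le> k) * \<Gamma> k j) n m"
      using \<Gamma>_sym assms by (intro timesum_mono) (auto simp: loss_coeff_def \<Gamma>_nonneg)
    also have "\<dots> = timesum (\<lambda>j k. of_bool (R \<le> j) * \<Gamma> j k) n m + timesum (\<lambda>j k. of_bool (R \<le> j) * \<Gamma> j k) n m"
      unfolding timesum_add using timesum_transpose[of "\<lambda>j k. of_bool (R \<le> j) * \<Gamma> j k"] by simp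
    also have "\<dots> \<le> \<epsilon>" using R[of n m] by simp
    finally show "timesum (\<lambda>j k. of_bool (R < j \<or> R < k) * loss_coeff i j k) n m \<le> \<epsilon>" .
  qed
qed

lemma \<phi>_le:
  assumes "1 \<le> i" "i < j" "1 \<le> k"
  shows "\<phi> i j k \<le> real j"
proof -
  have "\<phi> i j k \<le> real i * \<phi> i j k"
    using assms \<phi>_nonneg[OF assms] by (simp add: mult_le_cancel_right1)
  also have "\<dots> \<le> (\<Sum>i=1..<j. real i * \<phi> i j k)"
    using assms by (intro member_le_sum) (auto simp: \<phi>_nonneg)
  finally show ?thesis using \<phi>_mass assms by simp
qed

text \<open>Large breaking particles \<open>j\<close> are controlled by the mass leaving the tail; for bounded \<open>j\<close> the
  coefficients \<open>\<phi>\<close> are bounded and a large collision partner \<open>k\<close> is controlled by the collision rate.\<close>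

lemma uniform_tail_gain:
  assumes "1 \<le> i"
  shows "uniform_tail (gain_coeff i)"
  unfolding uniform_tail_def
proof (intro allI impI)
  fix \<epsilon> :: real assume "0 < \<epsilon>"
  have "\<forall>\<^sub>F r in sequentially. tail_mass r < \<epsilon> / 2 \<and> i < r"
    using order_tendstoD(2)[OF tail_mass_tendsto, of "\<epsilon> / 2"] \<open>0 < \<epsilon>\<close> eventually_gt_at_top[of i]
    by (intro eventually_conj) auto
  then obtain J where J: "tail_mass J < \<epsilon> / 2" "i < J"
    by (auto simp: eventually_sequentially)
  then obtain R where R: "\<And>n m. timesum (\<lambda>j k. of_bool (R \<le> j) * \<Gamma> j k) n m \<le> \<epsilon> / (2 * J)"
    using collision_tail[of "\<epsilon> / (2 * J)"] \<open>0 < \<epsilon>\<close> by auto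
  let ?L = "\<lambda>i. of_bool (J \<le> i) * real i"
  let ?g = "\<lambda>j k. of_bool (R \<le> j) * \<Gamma> j k"
  show "\<exists>R. \<forall>n m. timesum (\<lambda>j k. of_bool (R < j \<or> R < k) * gain_coeff i j k) n m \<le> \<epsilon>"
  proof (intro exI allI)
    fix n m
    \<comment> \<open>If \<open>j < J\<close>, then being outside the square forces
      \<open>R < k\<close>, and \<open>\<phi> i j k <= J\<close>; this is the \<open>J\<close> in
      the bound \<open>\<epsilon> / (2 * J)\<close>.\<close>
    have "of_bool (max J R < j \<or> max J R < k) * gain_coeff i j k
        \<le> of_bool (J \<le> j) * gain_coeff i j k + real J * ?g k j" if "1 \<le> j" "1 \<le> k" for j k
    proof (cases "J \<le> j")
      case True
      then show ?thesis using gain_coeff_nonneg[OF assms that] \<Gamma>_nonneg[OF that(2,1)] by auto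
    next
      case False
      have "gain_coeff i j k \<le> real J * \<Gamma> k j"
        using \<phi>_le[OF assms, of j k] \<Gamma>_nonneg[OF that] \<Gamma>_sym[OF that] that False
        by (auto simp: gain_coeff_def intro!: mult_right_mono)
      then show ?thesis using False \<Gamma>_nonneg[OF that(2,1)] by auto
    qed
    then have "timesum (\<lambda>j k. of_bool (max J R < j \<or> max J R < k) * gain_coeff i j k) n m
        \<le> timesum (\<lambda>j k. of_bool (J \<le> j) * gain_coeff i j k + real J * ?g k j) n m"
      by (intro timesum_mono) auto
    also have "\<dots> = timesum (\<lambda>j k. of_bool (J \<le> j) * gain_coeff i j k) n m + real J * timesum ?g n m"
      unfolding timesum_add timesum_cmult using timesum_transpose[of ?g n m] by simp
    also have "timesum (\<lambda>j k. of_bool (J \<le> j) * gain_coeff i j k) n m \<le> timesum (dissipation ?L) n m"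
      using dissipation_tail[OF assms J(2)] by (intro timesum_mono) auto
    also have "\<dots> \<le> tail_mass J"
    proof -
      have "(\<lambda>i. real i * \<psi>in i) summable_on {J..}"
        using \<psi>in_summable by (rule summable_on_subset_banach) (use J assms in auto)
      then show ?thesis
        unfolding tail_mass_def using J assms by (intro energy_bounds slope_mono_real) auto
    qed
    also have "real J * timesum ?g n m \<le> real J * (\<epsilon> / (2 * J))"
      using R by (intro mult_left_mono) auto
    finally show "timesum (\<lambda>j k. of_bool (max J R < j \<or> max J R < k) * gain_coeff i j k) n m \<le> \<epsilon>"
      using J by simp
  qed
qed

lemma timesum_split:
  "timesum a n m = timesum (\<lambda>j k. of_bool (R < j \<or> R < k) * a j k) n m
    + h n * (\<Sum>l<m. quad a R (euler n l))"
proof -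
  have "quad a n (euler n l) = quad (\<lambda>j k. of_bool (R < j \<or> R < k) * a j k) n (euler n l)
    + quad a R (euler n l)" for l by (rule quad_split) (simp add: euler_support)
  then show ?thesis by (simp add: timesum_def sum.distrib distrib_left)
qed

text \<open>Inside the square of side \<open>R\<close> the rate is bounded by \<open>C\<close>,
  since the entries of the scheme are at most \<open>mass\<close>; outside, the whole accumulated
  rate is below \<epsilon>. So \<open>C\<close> depends on \<epsilon> but not on
  \<open>n\<close>.\<close>

lemma timesum_increment:
  assumes "uniform_tail a" and a: "\<And>j k. 1 \<le> j \<Longrightarrow> 1 \<le> k \<Longrightarrow> 0 \<le> a j k" and "0 < \<epsilon>"
  obtains C where "0 \<le> C"
    "\<And>n p q. p \<le> q \<Longrightarrow> timesum a n q - timesum a n p \<le> C * (h n * real (q - p)) + \<epsilon>"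
proof -
  obtain R where R: "\<And>n m. timesum (\<lambda>j k. of_bool (R < j \<or> R < k) * a j k) n m \<le> \<epsilon>"
    using assms(1,3) unfolding uniform_tail_def by blast
  define C where "C = mass\<^sup>2 * (\<Sum>j=1..R. \<Sum>k=1..R. a j k)"
  have "0 \<le> C" unfolding C_def by (intro mult_nonneg_nonneg sum_nonneg) (auto simp: a)
  moreover have "timesum a n q - timesum a n p \<le> C * (h n * real (q - p)) + \<epsilon>" if "p \<le> q" for n p q
  proof -
    let ?t = "\<lambda>j k. of_bool (R < j \<or> R < k) * a j k"
    have s: "(\<Sum>l<q. quad a R (euler n l)) - (\<Sum>l<p. quad a R (euler n l)) = (\<Sum>l=p..<q. quad a R (euler n l))"
      using that sum_diff_nat_ivl[of 0 p q "\<lambda>l. quad a R (euler n l)"] by (simp add: atLeast0LessThan)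
    have "(\<Sum>l=p..<q. quad a R (euler n l)) \<le> (\<Sum>l=p..<q. C)"
      unfolding C_def by (intro sum_mono quad_bounded) (auto simp: a euler_nonneg euler_le_mass)
    then have "h n * (\<Sum>l=p..<q. quad a R (euler n l)) \<le> h n * (real (q - p) * C)"
      using h_pos[of n] by (simp add: mult_left_mono)
    moreover have "timesum a n q - timesum a n p
        = timesum ?t n q - timesum ?t n p + h n * (\<Sum>l=p..<q. quad a R (euler n l))"
      unfolding timesum_split[of a n _ R] s[symmetric] by (simp add: right_diff_distrib)
    moreover have "0 \<le> timesum ?t n p" by (intro timesum_nonneg) (auto simp: a)
    ultimately show ?thesis using R[of n q] by (simp add: mult_ac)
  qed
  ultimately show ?thesis by (rule that)
qed

text \<open>The discrete mild equation. It requires \<open>i <= n\<close>, since the scheme vanishes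
  above \<open>n\<close> whereas \<open>\<psi>in i\<close> need not.\<close>

lemma euler_eq:
  assumes "1 \<le> i" "i \<le> n"
  shows "euler n m i = \<psi>in i + timesum (gain_coeff i) n m - of_bool (i \<noteq> 1) * timesum (loss_coeff i) n m"
  using assms by (induction m) (auto simp: timesum_def quad_net algebra_simps)

lemma euler_equicontinuous:
  assumes "1 \<le> i" "0 < \<epsilon>"
  obtains C where "0 \<le> C"
    "\<And>n p q. p \<le> q \<Longrightarrow> \<bar>euler n q i - euler n p i\<bar> \<le> C * (h n * real (q - p)) + \<epsilon>"
proof -
  obtain C1 where C1: "0 \<le> C1" "\<And>n p q. p \<le> q \<Longrightarrow>
      timesum (gain_coeff i) n q - timesum (gain_coeff i) n p \<le> C1 * (h n * real (q - p)) + \<epsilon> / 2"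
    using timesum_increment[OF uniform_tail_gain[OF assms(1)] gain_coeff_nonneg, of "\<epsilon> / 2"] assms by auto
  obtain C2 where C2: "0 \<le> C2" "\<And>n p q. p \<le> q \<Longrightarrow>
      timesum (loss_coeff i) n q - timesum (loss_coeff i) n p \<le> C2 * (h n * real (q - p)) + \<epsilon> / 2"
    using timesum_increment[OF uniform_tail_loss[OF assms(1)] loss_coeff_nonneg, of "\<epsilon> / 2"] assms by auto
  \<comment> \<open>Accumulated gain and loss both increase, so the upper bounds on their increments
    also bound the absolute value of the difference.\<close>
  have mono: "timesum a n p \<le> timesum a n q"
    if "p \<le> q" "\<And>j k. 1 \<le> j \<Longrightarrow> 1 \<le> k \<Longrightarrow> 0 \<le> a j k" for a n p q
    unfolding timesum_def using h_pos[of n] that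
    by (intro mult_left_mono sum_mono2 quad_nonneg) (auto simp: euler_nonneg)
  have "\<bar>euler n q i - euler n p i\<bar> \<le> (C1 + C2) * (h n * real (q - p)) + \<epsilon>" if pq: "p \<le> q" for n p q
  proof (cases "i \<le> n")
    case True
    let ?x = "h n * real (q - p)"
    have "timesum (gain_coeff i) n p \<le> timesum (gain_coeff i) n q"
      "timesum (loss_coeff i) n p \<le> timesum (loss_coeff i) n q"
      using pq assms(1) by (auto intro!: mono simp: gain_coeff_nonneg loss_coeff_nonneg)
    moreover have "(C1 + C2) * ?x = C1 * ?x + C2 * ?x" by (rule distrib_right)
    moreover have "0 \<le> C1 * ?x" "0 \<le> C2 * ?x" using C1(1) C2(1) h_pos[of n] by auto
    ultimately show ?thesis
      using C1(2)[OF pq, of n] C2(2)[OF pq, of n] euler_eq[OF assms(1) True] \<open>0 < \<epsilon>\<close>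
      by (cases "i = 1") (auto simp: abs_le_iff)
  next
    case False
    then show ?thesis using C1(1) C2(1) assms h_pos[of n] by (simp add: euler_support)
  qed
  moreover have "0 \<le> C1 + C2" using C1(1) C2(1) by simp
  ultimately show ?thesis by (rule that[rotated])
qed

section \<open>Time interpolation and compactness\<close>

definition U :: "nat \<Rightarrow> real \<Rightarrow> nat \<Rightarrow> real" where
  "U n t = euler n (nat \<lfloor>t / h n\<rfloor>)"

text \<open>\<open>U\<close> jumps at the grid times; rounding the two times down to the grid adds
  at most one step, which accounts for the extra \<open>h n\<close>.\<close>

lemma U_equicontinuous:
  assumes "1 \<le> i" "0 < \<epsilon>"
  obtains C where "0 \<le> C"
    "\<And>n s t. 0 \<le> s \<Longrightarrow> s \<le> t \<Longrightarrow> \<bar>U n t i - U n s i\<bar> \<le> C * (t - s + h n) + \<epsilon>"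
proof -
  obtain C where C: "0 \<le> C"
    "\<And>n p q. p \<le> q \<Longrightarrow> \<bar>euler n q i - euler n p i\<bar> \<le> C * (h n * real (q - p)) + \<epsilon>"
    using euler_equicontinuous[OF assms] by auto
  have "\<bar>U n t i - U n s i\<bar> \<le> C * (t - s + h n) + \<epsilon>" if st: "0 \<le> s" "s \<le> t" for n s t
  proof -
    let ?p = "nat \<lfloor>s / h n\<rfloor>" and ?q = "nat \<lfloor>t / h n\<rfloor>"
    have pos: "0 \<le> s / h n" "s / h n \<le> t / h n"
      using st h_pos[of n] by (auto simp: divide_right_mono)
    then have fl: "0 \<le> \<lfloor>s / h n\<rfloor>" "\<lfloor>s / h n\<rfloor> \<le> \<lfloor>t / h n\<rfloor>" "0 \<le> \<lfloor>t / h n\<rfloor>"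
      by (auto intro: floor_mono)
    then have pq: "?p \<le> ?q" by auto
    have "real (?q - ?p) = of_int \<lfloor>t / h n\<rfloor> - of_int \<lfloor>s / h n\<rfloor>"
      using fl by (simp add: of_nat_diff nat_mono)
    also have "\<dots> \<le> t / h n - s / h n + 1" by linarith
    finally have "h n * real (?q - ?p) \<le> h n * (t / h n - s / h n + 1)"
      using h_pos[of n] by (intro mult_left_mono) auto
    also have "\<dots> = t - s + h n" using h_pos[of n] by (simp add: field_simps)
    finally have "C * (h n * real (?q - ?p)) \<le> C * (t - s + h n)"
      using C(1) by (intro mult_left_mono)
    then show ?thesis using C(2)[OF pq, of n] by (simp add: U_def)
  qed
  then show ?thesis using C(1) that by blast
qed

lemma U_nonneg: "0 \<le> U n t i" and U_le_mass: "U n t i \<le> mass"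
  by (simp_all add: U_def euler_nonneg euler_le_mass)

text \<open>Since the \<open>U n\<close> are discontinuous, a diagonal subsequence is taken over
  pairs of a size and a non-negative rational time. The approximate equicontinuity, with
  \<open>h\<close> tending to 0, then carries the Cauchy property to every real time.\<close>

lemma convergent_subsequence:
  obtains \<sigma> \<psi> where "strict_mono (\<sigma> :: nat \<Rightarrow> nat)"
    "\<And>i t. 1 \<le> i \<Longrightarrow> 0 \<le> t \<Longrightarrow> (\<lambda>n. U (\<sigma> n) t i) \<longlonglongrightarrow> \<psi> i t"
proof -
  let ?S = "(UNIV :: nat set) \<times> {q \<in> \<rat>. 0 \<le> (q::real)}"
  have "countable {q \<in> \<rat>. 0 \<le> (q::real)}"
    by (rule countable_subset[OF _ countable_rat]) auto
  then have "countable ?S" by (intro countable_SIGMA) auto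
  moreover have "norm ((\<lambda>(i, t). U n t i) x) \<le> mass" for n x
    using U_nonneg U_le_mass by (cases x) auto
  ultimately obtain \<sigma> where \<sigma>: "strict_mono \<sigma>"
    "\<And>x. x \<in> ?S \<Longrightarrow> \<exists>l. (\<lambda>n. (\<lambda>(i, t). U (\<sigma> n) t i) x) \<longlonglongrightarrow> l"
    by (rule function_convergent_subsequence[where f = "\<lambda>n (i, t). U n t i"]) blast
  have "Cauchy (\<lambda>n. U (\<sigma> n) t i)" if it: "1 \<le> i" "0 \<le> t" for i t
  proof (rule metric_CauchyI)
    fix e :: real assume "0 < e"
    then obtain C where C: "0 \<le> C"
      "\<And>n s t. 0 \<le> s \<Longrightarrow> s \<le> t \<Longrightarrow> \<bar>U n t i - U n s i\<bar> \<le> C * (t - s + h n) + e / 6"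
      using U_equicontinuous[OF it(1), of "e / 6"] by auto
    \<comment> \<open>One \<open>d\<close> bounds the distance to a rational time, another the step
      size; \<open>C + 1\<close> avoids division by zero.\<close>
    define d where "d = e / 6 / (C + 1) / 2"
    have "0 < d" using \<open>0 < e\<close> C(1) by (simp add: d_def)
    have dC: "C * (d + d) \<le> e / 6"
    proof -
      have "C * (d + d) = e / 6 * (C / (C + 1))" unfolding d_def field_sum_of_halves by simp
      also have "\<dots> \<le> e / 6 * 1"
        using \<open>0 < e\<close> C(1) by (intro mult_left_mono) auto
      finally show ?thesis by simp
    qed
    obtain q where q: "q \<in> \<rat>" "t < q" "q < t + d"
      using Rats_dense_in_real[of t "t + d"] \<open>0 < d\<close> by auto
    have "(\<lambda>n. h (\<sigma> n)) \<longlonglongrightarrow> 0"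
      using LIMSEQ_subseq_LIMSEQ[OF h_tendsto \<sigma>(1)] by (simp add: o_def)
    then have "\<forall>\<^sub>F n in sequentially. h (\<sigma> n) < d"
      using \<open>0 < d\<close> by (simp add: order_tendstoD(2))
    then obtain N1 where N1: "\<And>n. N1 \<le> n \<Longrightarrow> h (\<sigma> n) < d"
      by (auto simp: eventually_sequentially)
    have near: "\<bar>U (\<sigma> n) q i - U (\<sigma> n) t i\<bar> \<le> e / 3" if "N1 \<le> n" for n
    proof -
      have "C * (q - t + h (\<sigma> n)) \<le> C * (d + d)"
        using q N1[OF that] C(1) by (intro mult_left_mono) auto
      then show ?thesis using C(2)[of t q "\<sigma> n"] q it dC by simp
    qed
    have "\<exists>l. (\<lambda>n. U (\<sigma> n) q i) \<longlonglongrightarrow> l" using \<sigma>(2)[of "(i, q)"] q it by auto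
    then have "Cauchy (\<lambda>n. U (\<sigma> n) q i)" using LIMSEQ_imp_Cauchy by blast
    then obtain N2 where N2: "\<And>m n. N2 \<le> m \<Longrightarrow> N2 \<le> n \<Longrightarrow> dist (U (\<sigma> m) q i) (U (\<sigma> n) q i) < e / 3"
      using \<open>0 < e\<close> metric_CauchyD[of _ "e / 3"] by (metis divide_pos_pos zero_less_numeral)
    show "\<exists>M. \<forall>m\<ge>M. \<forall>n\<ge>M. dist (U (\<sigma> m) t i) (U (\<sigma> n) t i) < e"
    proof (intro exI allI impI)
      fix m n assume "max N1 N2 \<le> m" "max N1 N2 \<le> n"
      then show "dist (U (\<sigma> m) t i) (U (\<sigma> n) t i) < e"
        using near[of m] near[of n] N2[of m n] unfolding dist_real_def by linarith
    qed
  qed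
  then have "(\<lambda>n. U (\<sigma> n) t i) \<longlonglongrightarrow> lim (\<lambda>n. U (\<sigma> n) t i)" if "1 \<le> i" "0 \<le> t" for i t
    using that by (simp add: Cauchy_convergent_iff convergent_LIMSEQ_iff)
  then show ?thesis using \<sigma>(1) by (rule that[rotated])
qed

end

section \<open>Passage to the limit\<close>

text \<open>Letting \<open>n\<close> grow in \<open>S n R' <= T n <= S n R + \<epsilon>\<close>
  shows that \<open>J R\<close> is already within \<epsilon> of its limit for the \<open>R\<close>
  that works uniformly in \<open>n\<close>.\<close>

lemma tendsto_interchange:
  fixes S :: "nat \<Rightarrow> nat \<Rightarrow> real"
  assumes le: "\<And>n R. S n R \<le> T n"
    and unif: "\<And>\<epsilon>. 0 < \<epsilon> \<Longrightarrow> \<exists>R. \<forall>n. T n \<le> S n R + \<epsilon>"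
    and lim: "\<And>R. (\<lambda>n. S n R) \<longlonglongrightarrow> J R"
    and L: "J \<longlonglongrightarrow> L" and inc: "incseq J"
  shows "T \<longlonglongrightarrow> L"
proof (rule LIMSEQ_I)
  fix r :: real assume "0 < r"
  then obtain R where R: "\<And>n. T n \<le> S n R + r / 3"
    using unif[of "r / 3"] by auto
  have "J R' \<le> J R + r / 3" for R'
  proof (rule LIMSEQ_le[OF lim tendsto_add[OF lim tendsto_const]])
    show "\<exists>N. \<forall>n\<ge>N. S n R' \<le> S n R + r / 3"
      using R le order_trans by blast
  qed
  then have 1: "L \<le> J R + r / 3" by (intro LIMSEQ_le_const2[OF L]) auto
  have 2: "J R \<le> L" by (rule incseq_le[OF inc L])
  obtain N where N: "\<And>n. N \<le> n \<Longrightarrow> norm (S n R - J R) < r / 3"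
    using LIMSEQ_D[OF lim, of "r / 3" R] \<open>0 < r\<close> by auto
  have "norm (T n - L) < r" if "N \<le> n" for n
    using N[OF that] 1 2 R[of n] le[of n R] \<open>0 < r\<close> unfolding real_norm_def by linarith
  then show "\<exists>no. \<forall>n\<ge>no. norm (T n - L) < r" by blast
qed

section \<open>Integrals of step functions and double series\<close>

lemma has_integral_step_cell:
  assumes "0 < h" "real m * h \<le> t" "t \<le> real (Suc m) * h"
  shows "((\<lambda>s. f (nat \<lfloor>s / h\<rfloor>)) has_integral ((t - real m * h) * f m)) {real m * h..t}"
proof -
  have "((\<lambda>s. f m) has_integral ((t - real m * h) *\<^sub>R f m)) (cbox (real m * h) t)"
    using has_integral_const_real[of "f m" "real m * h" t] assms(2) by simp
  \<comment> \<open>The floor may jump at the right endpoint, so the two functions are compared only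
    in the interior.\<close>
  then have "((\<lambda>s. f (nat \<lfloor>s / h\<rfloor>)) has_integral ((t - real m * h) *\<^sub>R f m)) (cbox (real m * h) t)"
  proof (rule has_integral_spike_interior)
    fix s assume "s \<in> box (real m * h) t"
    then have "real m \<le> s / h" "s / h < real m + 1"
      using assms by (auto simp: field_simps)
    then have "\<lfloor>s / h\<rfloor> = int m" by linarith
    then show "f (nat \<lfloor>s / h\<rfloor>) = f m" by simp
  qed
  then show ?thesis by simp
qed

lemma has_integral_step:
  assumes "0 < h"
  shows "((\<lambda>s. f (nat \<lfloor>s / h\<rfloor>)) has_integral (h * (\<Sum>l<m. f l))) {0..real m * h}"
proof (induction m)
  case 0
  show ?case using has_integral_refl(2)[of _ 0] by simp
next
  case (Suc m)
  have "((\<lambda>s. f (nat \<lfloor>s / h\<rfloor>)) has_integral (h * (\<Sum>l<m. f l) + (real (Suc m) * h - real m * h) * f m))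
    {0..real (Suc m) * h}"
    using assms
    by (intro has_integral_combine[OF _ _ Suc has_integral_step_cell]) (auto simp: mult_right_mono)
  then show ?case by (simp add: algebra_simps)
qed

lemma has_integral_step_floor:
  fixes t h :: real
  assumes "0 < h" "0 \<le> t"
  defines "m \<equiv> nat \<lfloor>t / h\<rfloor>"
  shows "((\<lambda>s. f (nat \<lfloor>s / h\<rfloor>)) has_integral (h * (\<Sum>l<m. f l) + (t - real m * h) * f m)) {0..t}"
    and "0 \<le> t - real m * h" "t - real m * h \<le> h"
proof -
  have "0 \<le> t / h" using assms by simp
  then have "real m \<le> t / h" "t / h \<le> real m + 1" unfolding m_def by linarith+
  then have b: "real m * h \<le> t" "t \<le> real (Suc m) * h"
    using assms(1) by (auto simp: field_simps)
  show "((\<lambda>s. f (nat \<lfloor>s / h\<rfloor>)) has_integral (h * (\<Sum>l<m. f l) + (t - real m * h) * f m)) {0..t}"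
    using b assms(1)
    by (intro has_integral_combine[OF _ _ has_integral_step has_integral_step_cell]) auto
  show "0 \<le> t - real m * h" "t - real m * h \<le> h" using b by (auto simp: algebra_simps)
qed

text \<open>Square sums increase and stay below the iterated sum. Conversely, each rectangle lies in
  a square, and its sum recovers the iterated sum by letting first the inner and then the outer
  bound grow.\<close>

lemma square_sums_tendsto_infsum:
  fixes f :: "nat \<Rightarrow> nat \<Rightarrow> ennreal"
  shows "(\<lambda>R. \<Sum>j=1..R. \<Sum>k=1..R. f j k) \<longlonglongrightarrow> (\<Sum>\<^sub>\<infinity>j\<in>{1..}. \<Sum>\<^sub>\<infinity>k\<in>{1..}. f j k)"
proof -
  define X where "X R = (\<Sum>j=1..R. \<Sum>k=1..R. f j k)" for R
  define g where "g j = (\<Sum>\<^sub>\<infinity>k\<in>{1..}. f j k)" for j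
  have rect: "(\<Sum>j=1..J. \<Sum>k=1..K. f j k) \<le> (\<Sum>j=1..J'. \<Sum>k=1..K'. f j k)"
    if "J \<le> J'" "K \<le> K'" for J J' K K'
  proof -
    have "(\<Sum>j=1..J. \<Sum>k=1..K. f j k) \<le> (\<Sum>j=1..J. \<Sum>k=1..K'. f j k)"
      using that by (intro sum_mono sum_mono2) auto
    also have "\<dots> \<le> (\<Sum>j=1..J'. \<Sum>k=1..K'. f j k)" using that by (intro sum_mono2) auto
    finally show ?thesis .
  qed
  have gl: "(\<lambda>K. \<Sum>k=1..K. f j k) \<longlonglongrightarrow> g j" for j
    unfolding g_def by (intro sum_atLeastAtMost_tendsto_infsum nonneg_summable_on_complete) simp
  have Gl: "(\<lambda>J. \<Sum>j=1..J. g j) \<longlonglongrightarrow> (\<Sum>\<^sub>\<infinity>j\<in>{1..}. g j)"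
    by (intro sum_atLeastAtMost_tendsto_infsum nonneg_summable_on_complete) simp
  have inc: "incseq X" unfolding incseq_def X_def using rect by blast
  have "(SUP R. X R) = (\<Sum>\<^sub>\<infinity>j\<in>{1..}. g j)"
  proof (rule antisym)
    show "(SUP R. X R) \<le> (\<Sum>\<^sub>\<infinity>j\<in>{1..}. g j)"
    proof (rule SUP_least)
      fix R
      have "incseq (\<lambda>K. \<Sum>k=1..K. f j k)" for j
        unfolding incseq_def by (intro allI impI sum_mono2) auto
      then have "X R \<le> (\<Sum>j=1..R. g j)"
        unfolding X_def by (intro sum_mono incseq_le[OF _ gl])
      also have "incseq (\<lambda>J. \<Sum>j=1..J. g j)"
        unfolding incseq_def by (intro allI impI sum_mono2) auto
      then have "(\<Sum>j=1..R. g j) \<le> (\<Sum>\<^sub>\<infinity>j\<in>{1..}. g j)" using Gl by (rule incseq_le)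
      finally show "X R \<le> (\<Sum>\<^sub>\<infinity>j\<in>{1..}. g j)" .
    qed
    have "(\<Sum>j=1..J. g j) \<le> (SUP R. X R)" for J
    proof (rule LIMSEQ_le_const2)
      show "(\<lambda>K. \<Sum>j=1..J. \<Sum>k=1..K. f j k) \<longlonglongrightarrow> (\<Sum>j=1..J. g j)"
        by (intro tendsto_sum gl)
      have "(\<Sum>j=1..J. \<Sum>k=1..K. f j k) \<le> (SUP R. X R)" for K
        using rect[of J "max J K" K "max J K"] by (intro SUP_upper2[of "max J K"]) (auto simp: X_def)
      then show "\<exists>N. \<forall>K\<ge>N. (\<Sum>j=1..J. \<Sum>k=1..K. f j k) \<le> (SUP R. X R)" by blast
    qed
    then show "(\<Sum>\<^sub>\<infinity>j\<in>{1..}. g j) \<le> (SUP R. X R)" by (intro LIMSEQ_le_const2[OF Gl]) auto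
  qed
  then show ?thesis using LIMSEQ_SUP[OF inc] by (simp add: X_def[abs_def] g_def)
qed

lemma quad_tendsto_infsum:
  assumes "\<And>j k. 1 \<le> j \<Longrightarrow> 1 \<le> k \<Longrightarrow> 0 \<le> a j k" "\<And>j. 1 \<le> j \<Longrightarrow> 0 \<le> u j"
  shows "(\<lambda>R. ennreal (quad a R u)) \<longlonglongrightarrow> (\<Sum>\<^sub>\<infinity>j\<in>{1..}. \<Sum>\<^sub>\<infinity>k\<in>{1..}. ennreal (a j k * u j * u k))"
proof -
  have "ennreal (quad a R u) = (\<Sum>j=1..R. \<Sum>k=1..R. ennreal (a j k * u j * u k))" for R
  proof -
    have "(\<Sum>j=1..R. \<Sum>k=1..R. ennreal (a j k * u j * u k))
        = (\<Sum>j=1..R. ennreal (\<Sum>k=1..R. a j k * u j * u k))"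
      using assms by (intro sum.cong refl sum_ennreal) auto
    also have "\<dots> = ennreal (quad a R u)"
      unfolding quad_def using assms by (intro sum_ennreal sum_nonneg) auto
    finally show ?thesis ..
  qed
  then show ?thesis using square_sums_tendsto_infsum by simp
qed

lemma quad_incseq:
  assumes "\<And>j k. 1 \<le> j \<Longrightarrow> 1 \<le> k \<Longrightarrow> 0 \<le> a j k" "\<And>j. 1 \<le> j \<Longrightarrow> 0 \<le> u j" "R \<le> P"
  shows "quad a R u \<le> quad a P u"
  unfolding quad_subset[OF assms(3)] using assms by (intro quad_mono) auto

lemma nn_integral_lebesgue_on_Ioo:
  fixes f :: "real \<Rightarrow> real"
  assumes "\<And>s. s \<in> {0<..<t} \<Longrightarrow> 0 \<le> f s" "(f has_integral I) {0..t}"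
  shows "(\<integral>\<^sup>+s. ennreal (f s) \<partial>lebesgue_on {0<..<t}) = ennreal I"
proof -
  have "(f has_integral I) {0<..<t}" using assms(2) has_integral_Icc_iff_Ioo by blast
  then have "(\<integral>\<^sup>+s. ennreal (f s) * indicator {0<..<t} s \<partial>lborel) = ennreal I"
    using assms(1) by (intro nn_integral_has_integral_lebesgue') auto
  then show ?thesis by (simp add: nn_integral_restrict_space nn_integral_completion)
qed

section \<open>The limit equation\<close>

locale breakage_limit = breakage +
  fixes \<sigma> :: "nat \<Rightarrow> nat" and \<psi> :: "nat \<Rightarrow> real \<Rightarrow> real"
  assumes \<sigma>: "strict_mono \<sigma>"
    and U_tendsto: "1 \<le> i \<Longrightarrow> 0 \<le> t \<Longrightarrow> (\<lambda>n. U (\<sigma> n) t i) \<longlonglongrightarrow> \<psi> i t"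
begin

lemma \<psi>_nonneg: "1 \<le> i \<Longrightarrow> 0 \<le> t \<Longrightarrow> 0 \<le> \<psi> i t"
  by (rule LIMSEQ_le_const[OF U_tendsto]) (auto simp: U_nonneg)

lemma h_\<sigma>_tendsto: "(\<lambda>n. h (\<sigma> n)) \<longlonglongrightarrow> 0"
  using LIMSEQ_subseq_LIMSEQ[OF h_tendsto \<sigma>] by (simp add: o_def)

lemma eventually_\<sigma>_ge: "\<forall>\<^sub>F n in sequentially. i \<le> \<sigma> n"
  using filterlim_subseq[OF \<sigma>] by (simp add: filterlim_at_top)

text \<open>The step size disappears in the limit, which leaves the modulus
  \<open>C * \<bar>t - s\<bar> + e / 2\<close> with \<open>C\<close> depending on
  \<open>e\<close>.\<close>

lemma \<psi>_continuous:
  assumes i: "1 \<le> i"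
  shows "continuous_on {0..} (\<psi> i)"
  unfolding continuous_on_iff
proof (intro ballI allI impI)
  fix s e :: real assume s: "s \<in> {0..}" and "0 < e"
  then obtain C where C: "0 \<le> C"
    "\<And>n s t. 0 \<le> s \<Longrightarrow> s \<le> t \<Longrightarrow> \<bar>U n t i - U n s i\<bar> \<le> C * (t - s + h n) + e / 2"
    using U_equicontinuous[OF i, of "e / 2"] by auto
  have mod: "\<bar>\<psi> i t - \<psi> i s\<bar> \<le> C * (t - s) + e / 2" if "0 \<le> s" "s \<le> t" for s t
  proof (rule LIMSEQ_le)
    show "(\<lambda>n. \<bar>U (\<sigma> n) t i - U (\<sigma> n) s i\<bar>) \<longlonglongrightarrow> \<bar>\<psi> i t - \<psi> i s\<bar>"
      using that i by (intro tendsto_intros U_tendsto) auto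
    have "(\<lambda>n. C * (t - s + h (\<sigma> n)) + e / 2) \<longlonglongrightarrow> C * (t - s + 0) + e / 2"
      by (intro tendsto_intros h_\<sigma>_tendsto)
    then show "(\<lambda>n. C * (t - s + h (\<sigma> n)) + e / 2) \<longlonglongrightarrow> C * (t - s) + e / 2" by simp
  qed (use C(2) that in auto)
  have mod': "\<bar>\<psi> i t - \<psi> i s\<bar> \<le> C * \<bar>t - s\<bar> + e / 2" if "0 \<le> t" for t
    using mod[of s t] mod[of t s] s that by (cases "s \<le> t") (auto simp: abs_minus_commute)
  define d where "d = e / 2 / (C + 1)"
  have "0 < d" using \<open>0 < e\<close> C(1) by (simp add: d_def)
  have "dist (\<psi> i t) (\<psi> i s) < e" if "t \<in> {0..}" "dist t s < d" for t
  proof -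
    have "C * \<bar>t - s\<bar> \<le> C * d" using that C(1) by (intro mult_left_mono) (auto simp: dist_real_def)
    also have "\<dots> < (C + 1) * d" using \<open>0 < d\<close> by simp
    also have "\<dots> = e / 2"
    proof -
      have "C + 1 \<noteq> 0" using C(1) by simp
      then show ?thesis using d_def by (metis nonzero_divide_eq_eq mult.commute)
    qed
    finally show ?thesis using mod'[of t] that by (simp add: dist_real_def)
  qed
  then show "\<exists>d>0. \<forall>t\<in>{0..}. dist t s < d \<longrightarrow> dist (\<psi> i t) (\<psi> i s) < e"
    using \<open>0 < d\<close> by blast
qed

lemma quad_\<psi>_continuous: "continuous_on {0..} (\<lambda>s. quad a R (\<lambda>i. \<psi> i s))"
  unfolding quad_def by (intro continuous_intros \<psi>_continuous) auto

lemma quad_\<psi>_nonneg: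
  assumes "\<And>j k. 1 \<le> j \<Longrightarrow> 1 \<le> k \<Longrightarrow> 0 \<le> a j k" "0 \<le> s"
  shows "0 \<le> quad a R (\<lambda>i. \<psi> i s)"
  using assms by (intro quad_nonneg) (auto simp: \<psi>_nonneg)

text \<open>For fixed \<open>R\<close> only finitely many components occur, all bounded by
  \<open>mass\<close>, so dominated convergence applies to the step functions. Their integrals
  differ from the Riemann sums by the incomplete last cell, at most
  \<open>h (\<sigma> n) * B\<close>.\<close>

lemma quad_integral_tendsto:
  assumes a: "\<And>j k. 1 \<le> j \<Longrightarrow> 1 \<le> k \<Longrightarrow> 0 \<le> a j k" and t: "0 \<le> t"
  shows "(\<lambda>n. h (\<sigma> n) * (\<Sum>l<nat \<lfloor>t / h (\<sigma> n)\<rfloor>. quad a R (euler (\<sigma> n) l)))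
    \<longlonglongrightarrow> integral {0..t} (\<lambda>s. quad a R (\<lambda>i. \<psi> i s))"
proof -
  define B where "B = mass\<^sup>2 * (\<Sum>j=1..R. \<Sum>k=1..R. a j k)"
  define m where "m n = nat \<lfloor>t / h (\<sigma> n)\<rfloor>" for n
  define f where "f n l = quad a R (euler (\<sigma> n) l)" for n l
  have f: "0 \<le> f n l" "f n l \<le> B" for n l
    unfolding f_def B_def
    by (rule quad_nonneg quad_bounded; simp add: a euler_nonneg euler_le_mass)+
  have I: "((\<lambda>s. f n (nat \<lfloor>s / h (\<sigma> n)\<rfloor>)) has_integral
      (h (\<sigma> n) * (\<Sum>l<m n. f n l) + (t - real (m n) * h (\<sigma> n)) * f n (m n))) {0..t}" for n
    unfolding m_def using h_pos t by (rule has_integral_step_floor)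
  have "(\<lambda>n. integral {0..t} (\<lambda>s. f n (nat \<lfloor>s / h (\<sigma> n)\<rfloor>)))
      \<longlonglongrightarrow> integral {0..t} (\<lambda>s. quad a R (\<lambda>i. \<psi> i s))"
  proof (rule dominated_convergence)
    show "(\<lambda>s. f n (nat \<lfloor>s / h (\<sigma> n)\<rfloor>)) integrable_on {0..t}" for n
      using I by (rule has_integral_integrable)
    show "(\<lambda>_. B) integrable_on {0..t}" by (rule integrable_const_ivl)
    show "norm (f n (nat \<lfloor>s / h (\<sigma> n)\<rfloor>)) \<le> B" for n s using f by simp
    show "(\<lambda>n. f n (nat \<lfloor>s / h (\<sigma> n)\<rfloor>)) \<longlonglongrightarrow> quad a R (\<lambda>i. \<psi> i s)" if "s \<in> {0..t}" for s
      using that U_tendsto unfolding f_def U_def[symmetric] quad_def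
      by (intro tendsto_intros) (auto simp: U_def)
  qed
  then have 1: "(\<lambda>n. h (\<sigma> n) * (\<Sum>l<m n. f n l) + (t - real (m n) * h (\<sigma> n)) * f n (m n))
      \<longlonglongrightarrow> integral {0..t} (\<lambda>s. quad a R (\<lambda>i. \<psi> i s))"
    using integral_unique[OF I] by simp
  have 2: "(\<lambda>n. (t - real (m n) * h (\<sigma> n)) * f n (m n)) \<longlonglongrightarrow> 0"
  proof (rule tendsto_sandwich[where f = "\<lambda>_. 0" and h = "\<lambda>n. h (\<sigma> n) * B"])
    have b: "0 \<le> t - real (m n) * h (\<sigma> n)" "t - real (m n) * h (\<sigma> n) \<le> h (\<sigma> n)" for n
      unfolding m_def by (rule has_integral_step_floor(2,3)[OF h_pos t])+
    show "\<forall>\<^sub>F n in sequentially. 0 \<le> (t - real (m n) * h (\<sigma> n)) * f n (m n)"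
      using b f by (intro always_eventually allI mult_nonneg_nonneg)
    show "\<forall>\<^sub>F n in sequentially. (t - real (m n) * h (\<sigma> n)) * f n (m n) \<le> h (\<sigma> n) * B"
      using b f h_pos by (intro always_eventually allI mult_mono) (auto intro: less_imp_le)
    show "(\<lambda>n. h (\<sigma> n) * B) \<longlonglongrightarrow> 0"
      using tendsto_mult_right[OF h_\<sigma>_tendsto, of B] by simp
  qed simp
  show ?thesis using tendsto_diff[OF 1 2] by (simp add: f_def m_def)
qed

text \<open>Applied to gain and loss alike. Uniform tails allow \<open>n\<close> and
  \<open>R\<close> to tend to infinity in either order; monotone convergence identifies the limit in
  \<open>R\<close> with the integral of the full series.\<close>

lemma quad_limit:
  assumes ut: "uniform_tail a" and a: "\<And>j k. 1 \<le> j \<Longrightarrow> 1 \<le> k \<Longrightarrow> 0 \<le> a j k" and t: "0 < t"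
  defines "Q \<equiv> \<lambda>s. \<Sum>\<^sub>\<infinity>j\<in>{1..}. \<Sum>\<^sub>\<infinity>k\<in>{1..}. ennreal (a j k * \<psi> j s * \<psi> k s)"
  shows "L1_nonneg t Q"
    and "(\<lambda>n. timesum a (\<sigma> n) (nat \<lfloor>t / h (\<sigma> n)\<rfloor>)) \<longlonglongrightarrow> enn2real (\<integral>\<^sup>+s. Q s \<partial>lebesgue_on {0<..<t})"
proof -
  define J where "J R = integral {0..t} (\<lambda>s. quad a R (\<lambda>i. \<psi> i s))" for R
  define T where "T n = timesum a (\<sigma> n) (nat \<lfloor>t / h (\<sigma> n)\<rfloor>)" for n
  define S where "S n R = h (\<sigma> n) * (\<Sum>l<nat \<lfloor>t / h (\<sigma> n)\<rfloor>. quad a R (euler (\<sigma> n) l))" for n R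
  let ?M = "lebesgue_on {0<..<t}"
  have c: "continuous_on {0..t} (\<lambda>s. quad a R (\<lambda>i. \<psi> i s))" for R
    using quad_\<psi>_continuous by (rule continuous_on_subset) auto
  have SJ: "(\<lambda>n. S n R) \<longlonglongrightarrow> J R" for R
    unfolding S_def J_def using a t by (intro quad_integral_tendsto) auto
  have ST: "S n R \<le> T n" for n R
    using timesum_nonneg[of "\<lambda>j k. of_bool (R < j \<or> R < k) * a j k" "\<sigma> n" "nat \<lfloor>t / h (\<sigma> n)\<rfloor>"] a
      timesum_split[of a "\<sigma> n" "nat \<lfloor>t / h (\<sigma> n)\<rfloor>" R]
    by (simp add: S_def T_def)
  have unif: "\<exists>R. \<forall>n. T n \<le> S n R + \<epsilon>" if \<epsilon>: "0 < \<epsilon>" for \<epsilon>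
  proof -
    obtain R where R: "\<And>n m. timesum (\<lambda>j k. of_bool (R < j \<or> R < k) * a j k) n m \<le> \<epsilon>"
      using ut \<epsilon> unfolding uniform_tail_def by blast
    have "T n \<le> S n R + \<epsilon>" for n
      using R[of "\<sigma> n" "nat \<lfloor>t / h (\<sigma> n)\<rfloor>"] timesum_split[of a "\<sigma> n" "nat \<lfloor>t / h (\<sigma> n)\<rfloor>" R]
      unfolding S_def T_def by linarith
    then show ?thesis by blast
  qed
  have inc: "incseq J"
    unfolding incseq_def J_def using a
    by (intro allI impI integral_le integrable_continuous_real c quad_incseq) (auto simp: \<psi>_nonneg)
  \<comment> \<open>The increment bound from step 0 with tolerance 1 bounds \<open>T\<close>, hence
    \<open>J\<close>, and an increasing bounded \<open>J\<close> has a finite limit.\<close>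
  obtain C where C: "0 \<le> C" "\<And>n p q. p \<le> q \<Longrightarrow> timesum a n q - timesum a n p \<le> C * (h n * real (q - p)) + 1"
    using timesum_increment[OF ut a, of 1] by auto
  have "T n \<le> C * t + 1" for n
  proof -
    have "T n \<le> C * (h (\<sigma> n) * real (nat \<lfloor>t / h (\<sigma> n)\<rfloor>)) + 1"
      using C(2)[of 0 "nat \<lfloor>t / h (\<sigma> n)\<rfloor>" "\<sigma> n"] by (simp add: T_def timesum_def)
    also have "h (\<sigma> n) * real (nat \<lfloor>t / h (\<sigma> n)\<rfloor>) \<le> t"
      using has_integral_step_floor(2)[OF h_pos, of t "\<sigma> n"] t by (simp add: mult.commute)
    finally show ?thesis using C(1) by (simp add: mult_left_mono)
  qed
  then have "J R \<le> C * t + 1" for R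
    using ST by (intro LIMSEQ_le_const2[OF SJ]) (meson order_trans)
  then obtain L where L: "J \<longlonglongrightarrow> L"
    using incseq_convergent[OF inc] by blast
  have TL: "T \<longlonglongrightarrow> L" using ST unif SJ L inc by (rule tendsto_interchange)
  have Jnn: "0 \<le> J R" for R
    unfolding J_def using a by (intro integral_nonneg integrable_continuous_real c quad_\<psi>_nonneg) auto
  then have Lnn: "0 \<le> L" using L by (intro LIMSEQ_le_const) auto
  have Qlim: "(\<lambda>R. ennreal (quad a R (\<lambda>i. \<psi> i s))) \<longlonglongrightarrow> Q s" if "s \<in> space ?M" for s
    unfolding Q_def using a that by (intro quad_tendsto_infsum) (auto simp: \<psi>_nonneg)
  have meas: "(\<lambda>s. ennreal (quad a R (\<lambda>i. \<psi> i s))) \<in> borel_measurable ?M" for R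
  proof -
    have "(\<lambda>s. quad a R (\<lambda>i. \<psi> i s)) \<in> borel_measurable ?M"
      by (intro continuous_imp_measurable_on_sets_lebesgue continuous_on_subset[OF c]) auto
    then show ?thesis by measurable
  qed
  have Qmeas: "Q \<in> borel_measurable ?M"
    using Qlim meas by (rule borel_measurable_LIMSEQ_order)
  have qinc: "ennreal (quad a R (\<lambda>i. \<psi> i s)) \<le> ennreal (quad a P (\<lambda>i. \<psi> i s))"
    if "s \<in> space ?M" "R \<le> P" for s R P
    using a that by (intro ennreal_leI quad_incseq) (auto simp: \<psi>_nonneg)
  have "(\<integral>\<^sup>+s. Q s \<partial>?M) = (\<integral>\<^sup>+s. (SUP R. ennreal (quad a R (\<lambda>i. \<psi> i s))) \<partial>?M)"
  proof (rule nn_integral_cong)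
    fix s assume s: "s \<in> space ?M"
    have "incseq (\<lambda>R. ennreal (quad a R (\<lambda>i. \<psi> i s)))"
      using qinc[OF s] by (simp add: incseq_def)
    then show "Q s = (SUP R. ennreal (quad a R (\<lambda>i. \<psi> i s)))"
      using LIMSEQ_unique[OF Qlim[OF s] LIMSEQ_SUP] by simp
  qed
  also have "\<dots> = (SUP R. \<integral>\<^sup>+s. ennreal (quad a R (\<lambda>i. \<psi> i s)) \<partial>?M)"
    using meas by (intro nn_integral_monotone_convergence_SUP_AE AE_I2 qinc) auto
  also have "\<dots> = (SUP R. ennreal (J R))"
    unfolding J_def using a
    by (intro SUP_cong refl nn_integral_lebesgue_on_Ioo integrable_integral
        integrable_continuous_real c quad_\<psi>_nonneg) auto
  also have "\<dots> = ennreal L"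
  proof (rule LIMSEQ_unique[OF LIMSEQ_SUP])
    show "incseq (\<lambda>R. ennreal (J R))" using inc by (auto simp: incseq_def intro: ennreal_leI)
    show "(\<lambda>R. ennreal (J R)) \<longlonglongrightarrow> ennreal L" using L Jnn by (intro tendsto_ennrealI)
  qed
  finally have int: "(\<integral>\<^sup>+s. Q s \<partial>?M) = ennreal L" .
  show "L1_nonneg t Q" using Qmeas int by (simp add: L1_nonneg_def)
  show "(\<lambda>n. timesum a (\<sigma> n) (nat \<lfloor>t / h (\<sigma> n)\<rfloor>)) \<longlonglongrightarrow> enn2real (\<integral>\<^sup>+s. Q s \<partial>?M)"
    using TL Lnn by (simp add: int T_def[abs_def])
qed

lemma gain_eq:
  assumes "1 \<le> i"
  shows "gain \<phi> \<Gamma> u i = (\<Sum>\<^sub>\<infinity>j\<in>{1..}. \<Sum>\<^sub>\<infinity>k\<in>{1..}. ennreal (gain_coeff i j k * u j * u k))"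
  unfolding gain_def by (rule infsum_cong_neutral) (auto simp: gain_coeff_def)

lemma loss_eq:
  assumes "1 \<le> i"
  shows "loss \<Gamma> u i = (\<Sum>\<^sub>\<infinity>j\<in>{1..}. \<Sum>\<^sub>\<infinity>k\<in>{1..}. ennreal (loss_coeff i j k * u j * u k))"
proof -
  have "(\<Sum>\<^sub>\<infinity>j\<in>{1..}. \<Sum>\<^sub>\<infinity>k\<in>{1..}. ennreal (loss_coeff i j k * u j * u k))
      = (\<Sum>\<^sub>\<infinity>j\<in>{i}. \<Sum>\<^sub>\<infinity>k\<in>{1..}. ennreal (loss_coeff i j k * u j * u k))"
    using assms by (intro infsum_cong_neutral) (auto simp: loss_coeff_def)
  then show ?thesis by (simp add: loss_def loss_coeff_def)
qed

lemma mild_equation: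
  assumes i: "1 \<le> i" and t: "0 < t"
  shows "L1_nonneg t (\<lambda>s. gain \<phi> \<Gamma> (\<lambda>j. \<psi> j s) i)"
    and "L1_nonneg t (\<lambda>s. loss \<Gamma> (\<lambda>j. \<psi> j s) i)"
    and "\<psi> i t = \<psi>in i
          + enn2real (\<integral>\<^sup>+ s. gain \<phi> \<Gamma> (\<lambda>j. \<psi> j s) i \<partial>lebesgue_on {0<..<t})
          - (1 - of_bool (i = 1)) *
              enn2real (\<integral>\<^sup>+ s. loss \<Gamma> (\<lambda>j. \<psi> j s) i \<partial>lebesgue_on {0<..<t})"
proof -
  note g = quad_limit[OF uniform_tail_gain[OF i] gain_coeff_nonneg[OF i] t, folded gain_eq[OF i]]
  note l = quad_limit[OF uniform_tail_loss[OF i] loss_coeff_nonneg[OF i] t, folded loss_eq[OF i]]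
  show "L1_nonneg t (\<lambda>s. gain \<phi> \<Gamma> (\<lambda>j. \<psi> j s) i)" "L1_nonneg t (\<lambda>s. loss \<Gamma> (\<lambda>j. \<psi> j s) i)"
    using g(1) l(1) by auto
  let ?m = "\<lambda>n. nat \<lfloor>t / h (\<sigma> n)\<rfloor>"
  show "\<psi> i t = \<psi>in i
          + enn2real (\<integral>\<^sup>+ s. gain \<phi> \<Gamma> (\<lambda>j. \<psi> j s) i \<partial>lebesgue_on {0<..<t})
          - (1 - of_bool (i = 1)) *
              enn2real (\<integral>\<^sup>+ s. loss \<Gamma> (\<lambda>j. \<psi> j s) i \<partial>lebesgue_on {0<..<t})"
  proof (rule LIMSEQ_unique)
    show "(\<lambda>n. \<psi>in i + timesum (gain_coeff i) (\<sigma> n) (?m n)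
        - (1 - of_bool (i = 1)) * timesum (loss_coeff i) (\<sigma> n) (?m n)) \<longlonglongrightarrow>
        \<psi>in i + enn2real (\<integral>\<^sup>+ s. gain \<phi> \<Gamma> (\<lambda>j. \<psi> j s) i \<partial>lebesgue_on {0<..<t})
          - (1 - of_bool (i = 1)) *
              enn2real (\<integral>\<^sup>+ s. loss \<Gamma> (\<lambda>j. \<psi> j s) i \<partial>lebesgue_on {0<..<t})"
      by (intro tendsto_intros g(2) l(2))
    \<comment> \<open>Only eventually, because \<open>euler_eq\<close> requires
      \<open>i <= \<sigma> n\<close>.\<close>
    have "\<forall>\<^sub>F n in sequentially. U (\<sigma> n) t i = \<psi>in i + timesum (gain_coeff i) (\<sigma> n) (?m n)
        - (1 - of_bool (i = 1)) * timesum (loss_coeff i) (\<sigma> n) (?m n)"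
      using eventually_\<sigma>_ge[of i]
      by eventually_elim (use euler_eq[OF i] in \<open>simp add: U_def of_bool_not_iff\<close>)
    then show "(\<lambda>n. \<psi>in i + timesum (gain_coeff i) (\<sigma> n) (?m n)
        - (1 - of_bool (i = 1)) * timesum (loss_coeff i) (\<sigma> n) (?m n)) \<longlonglongrightarrow> \<psi> i t"
      using U_tendsto[OF i, of t] t by (simp add: tendsto_cong)
  qed
qed

end

section \<open>Moments and measurability of the limit\<close>

text \<open>The common tail bound \<open>T\<close> excludes escape of mass to infinity, which
  upgrades componentwise convergence to convergence in norm.\<close>

lemma Y1_norm_diff_tendsto_0:
  fixes v :: "nat \<Rightarrow> nat \<Rightarrow> real"
  assumes v: "\<And>n. v n \<in> Y1" and w: "w \<in> Y1"
    and vT: "\<And>n r. 1 \<le> r \<Longrightarrow> (\<Sum>\<^sub>\<infinity>i\<in>{r..}. real i * \<bar>v n i\<bar>) \<le> T r"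
    and wT: "\<And>r. 1 \<le> r \<Longrightarrow> (\<Sum>\<^sub>\<infinity>i\<in>{r..}. real i * \<bar>w i\<bar>) \<le> T r"
    and T: "T \<longlonglongrightarrow> 0"
    and lim: "\<And>i. 1 \<le> i \<Longrightarrow> (\<lambda>n. v n i) \<longlonglongrightarrow> w i"
  shows "(\<lambda>n. Y1_norm (\<lambda>i. v n i - w i)) \<longlonglongrightarrow> 0"
proof (rule LIMSEQ_I)
  fix e :: real assume "0 < e"
  let ?d = "\<lambda>n i. real i * \<bar>v n i - w i\<bar>"
  have "\<forall>\<^sub>F r in sequentially. T r < e / 4 \<and> 1 \<le> r"
    using order_tendstoD(2)[OF T, of "e / 4"] \<open>0 < e\<close> eventually_ge_at_top[of "1::nat"]
    by (intro eventually_conj) auto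
  then obtain r where r: "T r < e / 4" "1 \<le> r" by (auto simp: eventually_sequentially)
  have le: "?d n i \<le> real i * \<bar>v n i\<bar> + real i * \<bar>w i\<bar>" for n i
    unfolding distrib_left[symmetric] by (intro mult_left_mono) auto
  have sv: "(\<lambda>i. real i * \<bar>v n i\<bar>) summable_on {1..}" for n using v by (simp add: Y1_def)
  have sw: "(\<lambda>i. real i * \<bar>w i\<bar>) summable_on {1..}" using w by (simp add: Y1_def)
  have sd: "?d n summable_on {1..}" for n
    by (rule summable_on_comparison_test[OF summable_on_add[OF sv sw] le]) simp
  have tail: "(\<Sum>\<^sub>\<infinity>i\<in>{r..}. ?d n i) \<le> 2 * T r" for n
  proof -
    have sub: "{r..} \<subseteq> {1..}" using r by auto
    have "(\<Sum>\<^sub>\<infinity>i\<in>{r..}. ?d n i) \<le> (\<Sum>\<^sub>\<infinity>i\<in>{r..}. real i * \<bar>v n i\<bar> + real i * \<bar>w i\<bar>)"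
      by (intro infsum_mono le summable_on_add summable_on_subset_banach[OF _ sub] sv sw sd)
    also have "\<dots> = (\<Sum>\<^sub>\<infinity>i\<in>{r..}. real i * \<bar>v n i\<bar>) + (\<Sum>\<^sub>\<infinity>i\<in>{r..}. real i * \<bar>w i\<bar>)"
      by (intro infsum_add summable_on_subset_banach[OF _ sub] sv sw)
    finally show ?thesis using vT[OF r(2), of n] wT[OF r(2)] by simp
  qed
  have "(\<lambda>n. \<Sum>i=1..<r. ?d n i) \<longlonglongrightarrow> (\<Sum>i=1..<r. real i * \<bar>w i - w i\<bar>)"
    by (intro tendsto_intros lim) auto
  then have "(\<lambda>n. \<Sum>i=1..<r. ?d n i) \<longlonglongrightarrow> 0" by simp
  then obtain N where N: "\<And>n. N \<le> n \<Longrightarrow> (\<Sum>i=1..<r. ?d n i) < e / 2"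
    using order_tendstoD(2)[of _ 0 sequentially "e / 2"] \<open>0 < e\<close>
    by (auto simp: eventually_sequentially)
  have "norm (Y1_norm (\<lambda>i. v n i - w i) - 0) < e" if "N \<le> n" for n
  proof -
    have "0 \<le> Y1_norm (\<lambda>i. v n i - w i)" unfolding Y1_norm_def by (intro infsum_nonneg) simp
    moreover have "Y1_norm (\<lambda>i. v n i - w i) = (\<Sum>i=1..<r. ?d n i) + (\<Sum>\<^sub>\<infinity>i\<in>{r..}. ?d n i)"
      unfolding Y1_norm_def by (rule infsum_split_tail[OF sd r(2)])
    ultimately show ?thesis using N[OF that] tail[of n] r by simp
  qed
  then show "\<exists>no. \<forall>n\<ge>no. norm (Y1_norm (\<lambda>i. v n i - w i) - 0) < e" by blast
qed

context breakage_limit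
begin

text \<open>Finite sums inherit the bound of \<open>energy_bounds\<close>, which is independent of
  \<open>n\<close>; since the terms are non-negative, summability and the bound on the full sum
  follow.\<close>

lemma moment_tail:
  assumes \<Lambda>: "slope_mono \<Lambda>" and sm: "(\<lambda>i. \<Lambda> i * \<psi>in i) summable_on {1..}"
    and r: "1 \<le> r" and t: "0 \<le> t"
  shows "(\<lambda>i. \<Lambda> i * \<psi> i t) summable_on {r..}"
    and "(\<Sum>\<^sub>\<infinity>i\<in>{r..}. \<Lambda> i * \<psi> i t) \<le> (\<Sum>\<^sub>\<infinity>i\<in>{r..}. \<Lambda> i * \<psi>in i)"
proof -
  let ?B = "\<Sum>\<^sub>\<infinity>i\<in>{r..}. \<Lambda> i * \<psi>in i"
  have nn: "0 \<le> \<Lambda> i * \<psi> i t" if "i \<in> {r..}" for i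
    using that \<Lambda> r t by (auto simp: slope_mono_def \<psi>_nonneg)
  have sm': "(\<lambda>i. \<Lambda> i * \<psi>in i) summable_on {r..}"
    using sm by (rule summable_on_subset_banach) (use r in auto)
  have N: "(\<Sum>i=r..N. \<Lambda> i * \<psi> i t) \<le> ?B" for N
  proof (rule LIMSEQ_le_const2)
    show "(\<lambda>n. \<Sum>i=r..N. \<Lambda> i * U (\<sigma> n) t i) \<longlonglongrightarrow> (\<Sum>i=r..N. \<Lambda> i * \<psi> i t)"
      using r t by (intro tendsto_intros U_tendsto) auto
    show "\<exists>n0. \<forall>n\<ge>n0. (\<Sum>i=r..N. \<Lambda> i * U (\<sigma> n) t i) \<le> ?B"
      unfolding U_def using energy_bounds(1)[OF \<Lambda> sm' r] by blast
  qed
  have F: "(\<Sum>i\<in>F. \<Lambda> i * \<psi> i t) \<le> ?B" if "finite F" "F \<subseteq> {r..}" for F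
  proof -
    have "F \<subseteq> {r..Max (insert 0 F)}" using that Max_ge[of "insert 0 F"] by auto
    then have "(\<Sum>i\<in>F. \<Lambda> i * \<psi> i t) \<le> (\<Sum>i=r..Max (insert 0 F). \<Lambda> i * \<psi> i t)"
      using nn by (intro sum_mono2) auto
    then show ?thesis using N order_trans by blast
  qed
  show s: "(\<lambda>i. \<Lambda> i * \<psi> i t) summable_on {r..}"
    using nn F by (intro nonneg_bdd_above_summable_on) (auto intro!: bdd_aboveI)
  show "(\<Sum>\<^sub>\<infinity>i\<in>{r..}. \<Lambda> i * \<psi> i t) \<le> ?B"
    using s F by (rule infsum_le_finite_sums)
qed

lemma abs_\<psi>_eq:
  assumes "1 \<le> r" "0 \<le> t"
  shows "(\<Sum>\<^sub>\<infinity>i\<in>{r..}. real i * \<bar>\<psi> i t\<bar>) = (\<Sum>\<^sub>\<infinity>i\<in>{r..}. real i * \<psi> i t)"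
  using assms by (intro infsum_cong) (auto simp: \<psi>_nonneg)

lemma \<psi>_tail_le: "1 \<le> r \<Longrightarrow> 0 \<le> t \<Longrightarrow> (\<Sum>\<^sub>\<infinity>i\<in>{r..}. real i * \<bar>\<psi> i t\<bar>) \<le> tail_mass r"
  using moment_tail(2)[OF slope_mono_real \<psi>in_summable] by (simp add: abs_\<psi>_eq tail_mass_def)

lemma \<psi>_Y1_plus: "0 \<le> t \<Longrightarrow> (\<lambda>i. \<psi> i t) \<in> Y1_plus"
proof -
  assume t: "0 \<le> t"
  have "(\<lambda>i. real i * \<psi> i t) summable_on {1..}"
    using moment_tail(1)[OF slope_mono_real \<psi>in_summable order_refl t] .
  then have "(\<lambda>i. real i * \<bar>\<psi> i t\<bar>) summable_on {1..}"
    by (rule summable_on_cong[THEN iffD1, rotated]) (use t in \<open>simp add: \<psi>_nonneg\<close>)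
  then show ?thesis using t by (simp add: Y1_plus_def Y1_def \<psi>_nonneg)
qed

text \<open>The scheme conserves mass exactly and carries at most \<open>tail_mass r\<close> in
  sizes from \<open>r\<close> on. The remaining finitely many components converge, so the limit can
  lack at most \<open>tail_mass r\<close>, for every \<open>r\<close>.\<close>

lemma mass_conservation:
  assumes t: "0 \<le> t"
  shows "Y1_norm (\<lambda>i. \<psi> i t) = mass"
proof (rule antisym)
  show "Y1_norm (\<lambda>i. \<psi> i t) \<le> mass"
    using \<psi>_tail_le[OF order_refl t] by (simp add: Y1_norm_def mass_def tail_mass_def)
  have "mass \<le> Y1_norm (\<lambda>i. \<psi> i t) + tail_mass r" if r: "1 \<le> r" for r
  proof -
    have ev: "(\<Sum>i=1..\<sigma> n. real i * \<psi>in i) \<le> (\<Sum>i=1..<r. real i * U (\<sigma> n) t i) + tail_mass r" for n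
    proof -
      have sm: "(\<lambda>i. real i * \<psi>in i) summable_on {r..}"
        using \<psi>in_summable by (rule summable_on_subset_banach) (use r in auto)
      have "(\<Sum>i=1..\<sigma> n. real i * \<psi>in i) = (\<Sum>i=1..\<sigma> n. real i * U (\<sigma> n) t i)"
        unfolding U_def by (rule euler_mass_eq[symmetric])
      also have "\<dots> \<le> (\<Sum>i\<in>{1..<r} \<union> {r..\<sigma> n}. real i * U (\<sigma> n) t i)"
        by (intro sum_mono2) (auto simp: U_nonneg)
      also have "\<dots> = (\<Sum>i=1..<r. real i * U (\<sigma> n) t i) + (\<Sum>i=r..\<sigma> n. real i * U (\<sigma> n) t i)"
        by (intro sum.union_disjoint) auto
      also have "(\<Sum>i=r..\<sigma> n. real i * U (\<sigma> n) t i) \<le> tail_mass r"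
        unfolding U_def tail_mass_def by (rule energy_bounds(1)[OF slope_mono_real sm r])
      finally show ?thesis by simp
    qed
    have "mass \<le> (\<Sum>i=1..<r. real i * \<psi> i t) + tail_mass r"
    proof (rule LIMSEQ_le)
      show "(\<lambda>n. \<Sum>i=1..\<sigma> n. real i * \<psi>in i) \<longlonglongrightarrow> mass"
        using LIMSEQ_subseq_LIMSEQ[OF sum_atLeastAtMost_tendsto_infsum[OF \<psi>in_summable] \<sigma>]
        by (simp add: o_def mass_def)
      show "(\<lambda>n. (\<Sum>i=1..<r. real i * U (\<sigma> n) t i) + tail_mass r)
          \<longlonglongrightarrow> (\<Sum>i=1..<r. real i * \<psi> i t) + tail_mass r"
        using t by (intro tendsto_intros U_tendsto) auto
    qed (use ev in blast)
    also have "(\<Sum>i=1..<r. real i * \<psi> i t) \<le> (\<Sum>\<^sub>\<infinity>i\<in>{1..}. real i * \<psi> i t)"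
      using t moment_tail(1)[OF slope_mono_real \<psi>in_summable order_refl t]
      by (intro finite_sum_le_infsum) (auto simp: \<psi>_nonneg)
    finally show ?thesis using abs_\<psi>_eq[OF order_refl t] by (simp add: Y1_norm_def)
  qed
  moreover have "(\<lambda>r. Y1_norm (\<lambda>i. \<psi> i t) + tail_mass r) \<longlonglongrightarrow> Y1_norm (\<lambda>i. \<psi> i t) + 0"
    by (intro tendsto_intros tail_mass_tendsto)
  ultimately show "mass \<le> Y1_norm (\<lambda>i. \<psi> i t)"
    by (intro LIMSEQ_le_const[of "\<lambda>r. Y1_norm (\<lambda>i. \<psi> i t) + tail_mass r"]) auto
qed

lemma \<psi>_strongly_measurable: "strongly_measurable_Y1 (\<lambda>t i. \<psi> i t)"
proof -
  \<comment> \<open>Samples are taken on a grid of mesh \<open>1 / n\<close>; the cap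
    \<open>n * n\<close>, that is time \<open>n\<close>, leaves finitely many values. For
    \<open>n = 0\<close> the quotient is 0, so sample times are never negative.\<close>
  define k where "k n t = min (nat \<lfloor>t * real n\<rfloor>) (n * n)" for n and t :: real
  define s where "s n t i = \<psi> i (real (k n t) / real n)" for n t i
  have "simple_function (lebesgue_on {0<..}) (s n)" for n
  proof -
    have [measurable]: "(\<lambda>t. t * real n) \<in> borel_measurable (lebesgue_on {0<..})"
      by (intro continuous_imp_measurable_on_sets_lebesgue continuous_intros) auto
    have k: "k n \<in> measurable (lebesgue_on {0<..}) (count_space UNIV)"
      unfolding k_def[abs_def] by measurable
    have "finite (k n ` space (lebesgue_on {0<..}))"
      by (rule finite_subset[of _ "{..n * n}"]) (auto simp: k_def)
    then have "simple_function (lebesgue_on {0<..}) (k n)"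
      unfolding simple_function_def by (intro conjI ballI measurable_sets[OF k]) auto
    then have "simple_function (lebesgue_on {0<..}) ((\<lambda>l i. \<psi> i (real l / real n)) \<circ> k n)"
      by (rule simple_function_compose)
    moreover have "(\<lambda>l i. \<psi> i (real l / real n)) \<circ> k n = s n" by (auto simp: s_def fun_eq_iff)
    ultimately show ?thesis by simp
  qed
  moreover have sY: "s n t \<in> Y1" for n t
    using \<psi>_Y1_plus[of "real (k n t) / real n"] by (simp add: s_def[abs_def] Y1_plus_def)
  moreover have "(\<lambda>n. Y1_norm (\<lambda>i. s n t i - \<psi> i t)) \<longlonglongrightarrow> 0" if t: "0 < t" for t
  proof (rule Y1_norm_diff_tendsto_0[where T = tail_mass])
    show "s n t \<in> Y1" for n by (rule sY)
    show "(\<lambda>i. \<psi> i t) \<in> Y1" using \<psi>_Y1_plus[of t] t by (simp add: Y1_plus_def)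
    show "(\<Sum>\<^sub>\<infinity>i\<in>{r..}. real i * \<bar>s n t i\<bar>) \<le> tail_mass r" if "1 \<le> r" for n r
      unfolding s_def using that by (intro \<psi>_tail_le) auto
    show "(\<Sum>\<^sub>\<infinity>i\<in>{r..}. real i * \<bar>\<psi> i t\<bar>) \<le> tail_mass r" if "1 \<le> r" for r
      using that t by (intro \<psi>_tail_le) auto
    have kt: "(\<lambda>n. real (k n t) / real n) \<longlonglongrightarrow> t"
    proof (rule tendsto_sandwich[where f = "\<lambda>n. t - 1 / real n" and h = "\<lambda>n. t"])
      have ev: "\<forall>\<^sub>F n in sequentially. t \<le> real n \<and> 0 < n"
        using eventually_ge_at_top[of "nat \<lceil>t\<rceil>"] eventually_gt_at_top[of "0::nat"]
        by eventually_elim (auto simp: nat_ceiling_le_eq)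
      have bounds: "t - 1 / real n \<le> real (k n t) / real n \<and> real (k n t) / real n \<le> t"
        if n: "t \<le> real n" "0 < n" for n
      proof -
        have "t * real n \<le> real n * real n" using n by (intro mult_right_mono) auto
        then have "\<lfloor>t * real n\<rfloor> \<le> int (n * n)" by (simp add: floor_le_iff)
        then have "k n t = nat \<lfloor>t * real n\<rfloor>" by (simp add: k_def min_def nat_le_iff)
        moreover have "0 \<le> t * real n" using t by simp
        ultimately have "t * real n - 1 \<le> real (k n t)" "real (k n t) \<le> t * real n" by linarith+
        then have "(t * real n - 1) / real n \<le> real (k n t) / real n"
          "real (k n t) / real n \<le> t * real n / real n"
          by (simp_all only: divide_right_mono of_nat_0_le_iff)
        then show ?thesis using n by (simp add: diff_divide_distrib)
      qed
      show "\<forall>\<^sub>F n in sequentially. t - 1 / real n \<le> real (k n t) / real n"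
        using ev by eventually_elim (use bounds in blast)
      show "\<forall>\<^sub>F n in sequentially. real (k n t) / real n \<le> t"
        using ev by eventually_elim (use bounds in blast)
      have "(\<lambda>n. t - 1 / real n) \<longlonglongrightarrow> t - 0" by (intro tendsto_intros lim_1_over_n)
      then show "(\<lambda>n. t - 1 / real n) \<longlonglongrightarrow> t" by simp
    qed simp
    show "(\<lambda>n. s n t i) \<longlonglongrightarrow> \<psi> i t" if "1 \<le> i" for i
      unfolding s_def
      by (rule continuous_on_tendsto_compose[OF \<psi>_continuous[OF that] kt]) (use t in auto)
  qed (rule tail_mass_tendsto)
  then have "AE t in lebesgue_on {0<..}. (\<lambda>n. Y1_norm (\<lambda>i. s n t i - \<psi> i t)) \<longlonglongrightarrow> 0"
    by (intro AE_I2) auto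
  ultimately show ?thesis unfolding strongly_measurable_Y1_def by blast
qed

lemma \<psi>_mild_solution: "global_mild_solution \<phi> \<Gamma> \<psi>in \<psi>"
proof -
  have "AE t in lebesgue_on {0<..}. Y1_norm (\<lambda>i. \<psi> i t) \<le> mass"
    by (intro AE_I2) (auto simp: mass_conservation)
  then have "(\<lambda>t i. \<psi> i t) \<in> Linf_Y1_plus"
    using \<psi>_strongly_measurable \<psi>_Y1_plus by (auto simp: Linf_Y1_plus_def)
  then show ?thesis
    unfolding global_mild_solution_def using \<psi>_nonneg \<psi>_continuous mild_equation by blast
qed

end

section \<open>Superlinear weights\<close>

text \<open>A convex function vanishing at 0 lies below its chords from the origin, so the chord
  slope increases.\<close>

lemma G1_inf_class_slope_mono:
  assumes "G \<in> G1_inf_class"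
  shows "slope_mono (\<lambda>i. G (real i))"
proof -
  have G: "convex_on {0..} G" "G 0 = 0" "\<And>x. 0 \<le> x \<Longrightarrow> 0 \<le> G x"
    using assms by (auto simp: G1_inf_class_def G1_class_def)
  have "G (real i) / real i \<le> G (real j) / real j" if ij: "1 \<le> i" "i \<le> j" for i j
  proof -
    define c where "c = real i / real j"
    have c: "0 \<le> c" "c \<le> 1" "c * real j = real i" using ij by (auto simp: c_def)
    have "G ((1 - c) *\<^sub>R 0 + c *\<^sub>R real j) \<le> (1 - c) * G 0 + c * G (real j)"
      using c by (intro convex_onD[OF G(1)]) auto
    then have "G (real i) \<le> c * G (real j)" using c G(2) by simp
    then show ?thesis using ij by (simp add: c_def field_simps)
  qed
  then show ?thesis using G(3) by (auto simp: slope_mono_def)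
qed

text \<open>By the mean value theorem the increment of \<open>G x / x\<close> over \<open>[j - 1, j]\<close> is
  \<open>(\<xi> * G' \<xi> - G \<xi>) / \<xi>\<^sup>2\<close> for some \<open>\<xi> < j\<close>.\<close>

lemma G1_inf_class_superlinear:
  assumes "G \<in> G1_inf_class"
  shows "filterlim (\<lambda>j. real j * (G (real j) / real j - G (real (j - 1)) / real (j - 1)))
    at_top sequentially"
  unfolding filterlim_at_top
proof
  fix Z :: real
  define F where "F z = (z * hderiv G z - G z) / z" for z
  have "\<forall>\<^sub>F z in at_top. max Z 0 \<le> F z"
    using assms unfolding G1_inf_class_def filterlim_at_top F_def by blast
  then obtain z0 where z0: "\<And>z. z0 \<le> z \<Longrightarrow> max Z 0 \<le> F z"
    by (auto simp: eventually_at_top_linorder)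
  have der: "(G has_real_derivative hderiv G x) (at x)" if "0 < x" for x
  proof -
    have "G differentiable_on {0..}"
      using assms by (simp add: G1_inf_class_def G1_class_def C2_halfline_def)
    then have "(G has_vector_derivative hderiv G x) (at x within {0..})"
      using that unfolding hderiv_def differentiable_on_def
      by (auto simp: vector_derivative_works)
    then have "(G has_vector_derivative hderiv G x) (at x within {0<..})"
      by (rule has_vector_derivative_within_subset) auto
    then show ?thesis using that
      by (simp add: has_real_derivative_iff_has_vector_derivative at_within_open[of x "{0<..}"])
  qed
  have "Z \<le> real j * (G (real j) / real j - G (real (j - 1)) / real (j - 1))"
    if j: "max 2 (nat \<lceil>z0\<rceil> + 1) \<le> j" for j
  proof -
    have j2: "2 \<le> j" and z0j: "z0 \<le> real (j - 1)" using j by linarith+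
    have "\<exists>z>real (j - 1). z < real j \<and> G (real j) / real j - G (real (j - 1)) / real (j - 1)
        = (real j - real (j - 1)) * ((z * hderiv G z - G z) / (z * z))"
    proof (rule MVT2)
      show "real (j - 1) < real j" using j2 by simp
      fix x assume "real (j - 1) \<le> x" "x \<le> real j"
      then have "0 < x" using j2 by simp
      then show "((\<lambda>x. G x / x) has_real_derivative (x * hderiv G x - G x) / (x * x)) (at x)"
        by (auto intro!: derivative_eq_intros der simp: mult.commute)
    qed
    then obtain z where z: "real (j - 1) < z" "z < real j"
      and eq: "G (real j) / real j - G (real (j - 1)) / real (j - 1) = (z * hderiv G z - G z) / (z * z)"
      using j2 by (auto simp: of_nat_diff)
    have "0 < z" using z j2 by linarith
    have F0: "max Z 0 \<le> F z" using z0j z by (intro z0) simp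
    have "Z \<le> 1 * F z" using F0 by simp
    \<comment> \<open>The factor exceeds 1 as \<open>z < j\<close>; enlarging needs
      \<open>0 <= F z\<close>, whence \<open>max Z 0\<close> in the choice of
      \<open>z0\<close>.\<close>
    also have "\<dots> \<le> real j / z * F z"
      using F0 \<open>0 < z\<close> z by (intro mult_right_mono) auto
    also have "\<dots> = real j * ((z * hderiv G z - G z) / (z * z))" by (simp add: F_def)
    finally show ?thesis unfolding eq .
  qed
  then show "\<forall>\<^sub>F j in sequentially. Z \<le> real j * (G (real j) / real j - G (real (j - 1)) / real (j - 1))"
    unfolding eventually_sequentially by blast
qed

theorem theorem1p4:
  fixes \<Gamma> :: "nat \<Rightarrow> nat \<Rightarrow> real"
    and \<phi> :: "nat \<Rightarrow> nat \<Rightarrow> nat \<Rightarrow> real"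
    and \<alpha>0 \<alpha>1 :: real
    and \<psi>in :: "nat \<Rightarrow> real"
    and G0 :: "real \<Rightarrow> real"
  assumes "\<And>i j. 1 \<le> i \<Longrightarrow> 1 \<le> j \<Longrightarrow> 0 \<le> \<Gamma> i j \<and> \<Gamma> i j = \<Gamma> j i"
    and "\<And>i j k. 2 \<le> j \<Longrightarrow> 1 \<le> i \<Longrightarrow> i \<le> j - 1 \<Longrightarrow> 1 \<le> k \<Longrightarrow> 0 \<le> \<phi> i j k"
    and "\<And>j k. 2 \<le> j \<Longrightarrow> 1 \<le> k \<Longrightarrow> (\<Sum>i=1..j-1. real i * \<phi> i j k) = real j"
    and "0 \<le> \<alpha>0" and "0 \<le> \<alpha>1"
    and "\<And>i j k. 2 \<le> j \<Longrightarrow> 1 \<le> i \<Longrightarrow> i \<le> j - 1 \<Longrightarrow> j \<le> k \<Longrightarrow> \<phi> i j k \<le> \<alpha>0 + \<alpha>1 * \<phi> i k j"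
    and "\<psi>in \<in> Y1_plus"
    and "G0 \<in> G1_inf_class"
    and "(\<lambda>i. G0 (real i) * \<psi>in i) summable_on {1..}"
  shows "\<exists>\<psi>. global_mild_solution \<phi> \<Gamma> \<psi>in \<psi> \<and>
    (\<forall>t\<ge>0. (\<lambda>i. \<psi> i t) \<in> Y1_plus \<and> Y1_norm (\<lambda>i. \<psi> i t) = Y1_norm \<psi>in) \<and>
    (\<forall>\<Lambda> :: nat \<Rightarrow> real.
       (\<forall>i\<ge>1. 0 \<le> \<Lambda> i) \<and> mono_on {1..} (\<lambda>i. \<Lambda> i / real i) \<and>
       (\<lambda>i. \<Lambda> i * \<psi>in i) summable_on {1..} \<longrightarrow>
       (\<forall>t>0. \<forall>r\<ge>1. (\<lambda>i. \<Lambda> i * \<psi> i t) summable_on {r..} \<and>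
          (\<Sum>\<^sub>\<infinity>i\<in>{r..}. \<Lambda> i * \<psi> i t) \<le> (\<Sum>\<^sub>\<infinity>i\<in>{r..}. \<Lambda> i * \<psi>in i)))"
proof -
  have \<psi>in: "(\<lambda>i. real i * \<bar>\<psi>in i\<bar>) summable_on {1..}" "\<And>i. 1 \<le> i \<Longrightarrow> 0 \<le> \<psi>in i"
    using assms(7) by (auto simp: Y1_plus_def Y1_def)
  have eq: "real i * \<bar>\<psi>in i\<bar> = real i * \<psi>in i" if "i \<in> {1..}" for i
    using \<psi>in(2) that by simp
  interpret breakage \<Gamma> \<phi> \<psi>in "\<lambda>i. G0 (real i)"
  proof
    show "(\<Sum>i=1..<j. real i * \<phi> i j k) = real j" if "2 \<le> j" "1 \<le> k" for j k
    proof -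
      have "{1..<j} = {1..j - 1}" using that by auto
      then show ?thesis using assms(3)[OF that] by simp
    qed
    show "(\<lambda>i. real i * \<psi>in i) summable_on {1..}"
      using \<psi>in(1) by (rule summable_on_cong[THEN iffD1, rotated]) (rule eq)
  qed (use assms \<psi>in(2) G1_inf_class_slope_mono G1_inf_class_superlinear in auto)
  obtain \<sigma> \<psi> where \<sigma>: "strict_mono (\<sigma> :: nat \<Rightarrow> nat)"
    and lim: "\<And>i t. 1 \<le> i \<Longrightarrow> 0 \<le> t \<Longrightarrow> (\<lambda>n. U (\<sigma> n) t i) \<longlonglongrightarrow> \<psi> i t"
    using convergent_subsequence by blast
  interpret breakage_limit \<Gamma> \<phi> \<psi>in "\<lambda>i. G0 (real i)" \<sigma> \<psi>
    by unfold_locales (use \<sigma> lim in auto)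
  have "Y1_norm \<psi>in = mass"
    unfolding Y1_norm_def mass_def by (rule infsum_cong[OF eq])
  moreover have "slope_mono \<Lambda>" if "\<forall>i\<ge>1. 0 \<le> \<Lambda> i" "mono_on {1..} (\<lambda>i. \<Lambda> i / real i)" for \<Lambda>
    using that unfolding slope_mono_def mono_on_def by auto
  ultimately show ?thesis
    using \<psi>_mild_solution \<psi>_Y1_plus mass_conservation moment_tail
    by (intro exI[of _ \<psi>] conjI allI impI) (auto simp del: One_nat_def)
qed

end
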